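(* Let $\boldsymbol{U}$ be an $n\times n$ unitary (respectively, real orthogonal) matrix, let $\boldsymbol{G}_k$ be a complex (respectively, real) $n\times n$ matrix of rank $k$, and let $\eta$ be a real number (the learning rate). Then projecting $\boldsymbol{G}_k$ onto the tangent space at $\boldsymbol{U}$ and performing a rotation in that direction, i.e. the update $$\boldsymbol{U}\;\to\;\boldsymbol{U}\exp\left[-\eta\,\boldsymbol{U}^\dagger\,\Pi_{T_{\boldsymbol{U}}}(\boldsymbol{G}_k)\right],\qquad \Pi_{T_{\boldsymbol{U}}}(\boldsymbol{X})=\tfrac12\left(\boldsymbol{X}-\boldsymbol{U}\boldsymbol{X}^\dagger\boldsymbol{U}\right),$$ can be performed in $O(k(n^2+nk+k^2))$ steps; that is, there is an algorithm which, given $\boldsymbol{U}$, $\boldsymbol{G}_k$ and $\eta$, outputs the updated matrix using $O(k(n^2+nk+k^2))$ steps, with an absolute implied constant.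
   Context: ${}^\dagger$ is the conjugate transpose (the transpose for real matrices) and $\exp$ is the matrix exponential. $T_{\boldsymbol{U}}$ is the tangent space $\{\boldsymbol{X}:\boldsymbol{U}^\dagger\boldsymbol{X}+\boldsymbol{X}^\dagger\boldsymbol{U}=0\}$ of the unitary (orthogonal) group at $\boldsymbol{U}$, and $\Pi_{T_{\boldsymbol{U}}}$ is the orthogonal projection onto it with respect to $\langle \boldsymbol{X},\boldsymbol{Y}\rangle=\operatorname{Re}(\operatorname{Tr}[\boldsymbol{X}^\dagger\boldsymbol{Y}])$. The input $\boldsymbol{U}$ is given by its entries, and the rank-$k$ matrix is given in factored form $\boldsymbol{G}_k=\sum_{i=1}^k\boldsymbol{a}_i\boldsymbol{b}_i^\dagger$ with vectors $\boldsymbol{a}_i,\boldsymbol{b}_i$ of length $n$. Steps are scalar arithmetic operations in exact arithmetic, including square roots and exponentials of scalars, and the eigendecomposition of an $m\times m$ matrix is counted as $O(m^3)$ steps. *)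

theory Defs
  imports
    "HOL-Analysis.Inner_Product"
    "Jordan_Normal_Form.Schur_Decomposition"
    "Jordan_Normal_Form.DL_Rank"
begin

section \<open>Unitary group, tangent space, update\<close>

text \<open>Everything is generic in the scalar type, which is instantiated by the complex and by the real
  numbers. Over the reals \<open>conjugate\<close> is the identity, so \<open>mat_adjoint\<close> is the transpose and
  \<open>unitary_mat\<close> means orthogonal.\<close>

definition unitary_mat :: "nat \<Rightarrow> 'a::conjugatable_field mat \<Rightarrow> bool" where
  "unitary_mat n U \<longleftrightarrow> U \<in> carrier_mat n n \<and> mat_adjoint U * U = 1\<^sub>m n"

definition mat_trace :: "'a::comm_monoid_add mat \<Rightarrow> 'a" where
  "mat_trace A = (\<Sum>i<dim_row A. A $$ (i, i))"

text \<open>\<open>inner 1 z\<close> is the real part of \<open>z\<close> over the complex numbers and \<open>z\<close> itself over the reals.\<close>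

definition re_trace_inner ::
    "'a::{conjugatable_field, real_inner} mat \<Rightarrow> 'a mat \<Rightarrow> real" where
  "re_trace_inner X Y = inner 1 (mat_trace (mat_adjoint X * Y))"

lemma re_trace_inner_complex:
  "re_trace_inner (X :: complex mat) Y = Re (mat_trace (mat_adjoint X * Y))"
  by (simp add: re_trace_inner_def inner_complex_def)

lemma re_trace_inner_real:
  "re_trace_inner (X :: real mat) Y = mat_trace (mat_adjoint X * Y)"
  by (simp add: re_trace_inner_def)

definition tangent_space :: "'a::conjugatable_field mat \<Rightarrow> 'a mat set" where
  "tangent_space U =
     {X \<in> carrier_mat (dim_row U) (dim_row U).
        mat_adjoint U * X + mat_adjoint X * U = 0\<^sub>m (dim_row U) (dim_row U)}"

definition tangent_proj ::
    "'a::{conjugatable_field, real_inner} mat \<Rightarrow> 'a mat \<Rightarrow> 'a mat" where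
  "tangent_proj U X =
     (THE P. P \<in> tangent_space U \<and> (\<forall>Y \<in> tangent_space U. re_trace_inner Y (X - P) = 0))"

definition mat_exp :: "'a::{real_normed_field, banach} mat \<Rightarrow> 'a mat" where
  "mat_exp A =
     mat (dim_row A) (dim_row A) (\<lambda>(i, j). \<Sum>m. (A ^\<^sub>m m) $$ (i, j) / fact m)"

definition rotation_update ::
    "'a::{conjugatable_field, real_inner, real_normed_field, banach} mat \<Rightarrow> 'a mat \<Rightarrow> real \<Rightarrow> 'a mat"
  where
  "rotation_update U G \<eta> = U * mat_exp (- of_real \<eta> \<cdot>\<^sub>m (mat_adjoint U * tangent_proj U G))"

definition sum_outer ::
    "nat \<Rightarrow> nat \<Rightarrow> (nat \<Rightarrow> 'a::conjugatable_field vec) \<Rightarrow> (nat \<Rightarrow> 'a vec) \<Rightarrow> 'a mat" where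
  "sum_outer n k a b = mat n n (\<lambda>(i, j). \<Sum>l<k. a l $ i * conjugate (b l $ j))"

section \<open>Eigendecomposition\<close>

definition is_eigendecomposition ::
    "nat \<Rightarrow> complex mat \<Rightarrow> complex mat \<Rightarrow> complex vec \<Rightarrow> bool" where
  "is_eigendecomposition m A P d \<longleftrightarrow>
     P \<in> carrier_mat m m \<and> d \<in> carrier_vec m \<and> invertible_mat P \<and>
     A * P = P * mat_diag m (\<lambda>i. d $ i) \<and>
     (A * mat_adjoint A = mat_adjoint A * A \<longrightarrow> unitary_mat m P)"

text \<open>An eigensolver returns some eigendecomposition (with an orthonormal eigenbasis if the matrix is
  normal) whenever there is one. Nothing is assumed about which one is returned, nor about the
  result on matrices that are not diagonalizable.\<close>

definition is_eigensolver :: "(complex mat \<Rightarrow> complex mat \<times> complex vec) \<Rightarrow> bool" where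
  "is_eigensolver E \<longleftrightarrow>
     (\<forall>m. \<forall>A \<in> carrier_mat m m.
        (\<exists>P d. is_eigendecomposition m A P d) \<longrightarrow> is_eigendecomposition m A (fst (E A)) (snd (E A)))"

lemma eigensolver_exists: "\<exists>E. is_eigensolver E"
proof
  let ?E = "\<lambda>A. SOME x. is_eigendecomposition (dim_row A) A (fst x) (snd x)"
  show "is_eigensolver ?E"
    unfolding is_eigensolver_def
  proof (intro allI ballI impI)
    fix m and A :: "complex mat"
    assume A: "A \<in> carrier_mat m m" and "\<exists>P d. is_eigendecomposition m A P d"
    then have "\<exists>x. is_eigendecomposition (dim_row A) A (fst x) (snd x)" by auto
    from someI_ex[OF this] A
    show "is_eigendecomposition m A (fst (?E A)) (snd (?E A))"
      by simp
  qed
qed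

section \<open>Machine model\<close>

text \<open>
  An algorithm is a single finite program, the same for all dimensions. It works on index variables
  (natural numbers) and on arrays of complex scalars with two indices. Scalars can influence
  indices and control flow only through the tests \<open>Equal\<close> and \<open>ReLe\<close>. The only loops are
  bounded ones, so every program terminates. The only scalar literals are the integers and the
  imaginary unit.

  The evaluation of index expressions is free. One step is charged for each scalar instruction, each
  index assignment, each test and each loop iteration, in addition to the steps of its body. The
  eigendecomposition of an m by m matrix costs \<open>K * m ^ 3\<close> steps, where \<open>K\<close> is the constant implied
  in the cost O(m^3).
\<close>

type_synonym vname = string

type_synonym store = "(vname \<Rightarrow> nat) \<times> (vname \<Rightarrow> nat \<Rightarrow> nat \<Rightarrow> complex)"

datatype iexp = Num nat | Idx vname | IPlus iexp iexp | IMinus iexp iexp | ITimes iexp iexp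

datatype cell = Cell vname iexp iexp

datatype scalar_op =
    IntLit int | ImagUnit | Copy cell
  | Add cell cell | Sub cell cell | Mul cell cell | Div cell cell
  | Conj cell | RePart cell | ImPart cell | Sqrt cell | Exp cell

datatype test = Equal cell cell | ReLe cell cell | IdxLess iexp iexp

datatype com =
    Skip
  | Assign cell scalar_op
  | SetIdx vname iexp
  | Seq com com
  | Cond test com com
  | For vname iexp com
  | Eigen iexp vname vname vname

primrec ival :: "store \<Rightarrow> iexp \<Rightarrow> nat" where
  "ival s (Num n) = n"
| "ival s (Idx x) = fst s x"
| "ival s (IPlus e f) = ival s e + ival s f"
| "ival s (IMinus e f) = ival s e - ival s f"
| "ival s (ITimes e f) = ival s e * ival s f"

primrec cval :: "store \<Rightarrow> cell \<Rightarrow> complex" where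
  "cval s (Cell x e f) = snd s x (ival s e) (ival s f)"

primrec opval :: "store \<Rightarrow> scalar_op \<Rightarrow> complex" where
  "opval s (IntLit z) = of_int z"
| "opval s ImagUnit = \<i>"
| "opval s (Copy p) = cval s p"
| "opval s (Add p q) = cval s p + cval s q"
| "opval s (Sub p q) = cval s p - cval s q"
| "opval s (Mul p q) = cval s p * cval s q"
| "opval s (Div p q) = cval s p / cval s q"
| "opval s (Conj p) = cnj (cval s p)"
| "opval s (RePart p) = of_real (Re (cval s p))"
| "opval s (ImPart p) = of_real (Im (cval s p))"
| "opval s (Sqrt p) = csqrt (cval s p)"
| "opval s (Exp p) = exp (cval s p)"

primrec tval :: "store \<Rightarrow> test \<Rightarrow> bool" where
  "tval s (Equal p q) \<longleftrightarrow> cval s p = cval s q"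
| "tval s (ReLe p q) \<longleftrightarrow> Re (cval s p) \<le> Re (cval s q)"
| "tval s (IdxLess e f) \<longleftrightarrow> ival s e < ival s f"

primrec write_cell :: "cell \<Rightarrow> complex \<Rightarrow> store \<Rightarrow> store" where
  "write_cell (Cell x e f) z s =
     (fst s, (snd s)(x := (snd s x)(ival s e := (snd s x (ival s e))(ival s f := z))))"

definition write_index :: "vname \<Rightarrow> nat \<Rightarrow> store \<Rightarrow> store" where
  "write_index x i s = ((fst s)(x := i), snd s)"

definition write_block :: "vname \<Rightarrow> nat \<Rightarrow> nat \<Rightarrow> (nat \<Rightarrow> nat \<Rightarrow> complex) \<Rightarrow> store \<Rightarrow> store" where
  "write_block x p q F s =
     (fst s, (snd s)(x := (\<lambda>i j. if i < p \<and> j < q then F i j else snd s x i j)))"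

primrec iterate :: "(nat \<Rightarrow> store \<Rightarrow> store \<times> nat) \<Rightarrow> nat \<Rightarrow> store \<Rightarrow> store \<times> nat" where
  "iterate f 0 s = (s, 0)"
| "iterate f (Suc i) s =
     (let (s1, t1) = iterate f i s; (s2, t2) = f i s1 in (s2, t1 + Suc t2))"

text \<open>\<open>exec K E c s\<close> is the final store together with the number of steps. The command
  \<open>Eigen e x y z\<close> decomposes the leading block of the array \<open>x\<close> whose size is the value of \<open>e\<close>,
  and stores the eigenvectors as the columns of \<open>y\<close> and the eigenvalues in column 0 of \<open>z\<close>.\<close>

primrec exec ::
    "nat \<Rightarrow> (complex mat \<Rightarrow> complex mat \<times> complex vec) \<Rightarrow> com \<Rightarrow> store \<Rightarrow> store \<times> nat" where
  "exec K E Skip = (\<lambda>s. (s, 0))"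
| "exec K E (Assign p r) = (\<lambda>s. (write_cell p (opval s r) s, 1))"
| "exec K E (SetIdx x e) = (\<lambda>s. (write_index x (ival s e) s, 1))"
| "exec K E (Seq c1 c2) =
     (\<lambda>s. let (s1, t1) = exec K E c1 s; (s2, t2) = exec K E c2 s1 in (s2, t1 + t2))"
| "exec K E (Cond b c1 c2) =
     (\<lambda>s. let (s1, t1) = (if tval s b then exec K E c1 s else exec K E c2 s) in (s1, Suc t1))"
| "exec K E (For x e c) = (\<lambda>s. iterate (\<lambda>i s'. exec K E c (write_index x i s')) (ival s e) s)"
| "exec K E (Eigen e x y z) =
     (\<lambda>s. let m = ival s e; (P, d) = E (mat m m (\<lambda>(i, j). snd s x i j)) in
        (write_block z m 1 (\<lambda>i j. d $ i) (write_block y m m (\<lambda>i j. P $$ (i, j)) s), K * m ^ 3))"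

text \<open>Input and output conventions. \<open>emb\<close> embeds the scalars of the problem into the complex numbers.
  The contents of all other variables and cells are arbitrary at the start.\<close>

definition holds_matrix ::
    "('a \<Rightarrow> complex) \<Rightarrow> vname \<Rightarrow> nat \<Rightarrow> 'a mat \<Rightarrow> store \<Rightarrow> bool" where
  "holds_matrix emb x n M s \<longleftrightarrow> (\<forall>i<n. \<forall>j<n. snd s x i j = emb (M $$ (i, j)))"

definition holds_vectors ::
    "('a \<Rightarrow> complex) \<Rightarrow> vname \<Rightarrow> nat \<Rightarrow> nat \<Rightarrow> (nat \<Rightarrow> 'a vec) \<Rightarrow> store \<Rightarrow> bool" where
  "holds_vectors emb x n k v s \<longleftrightarrow> (\<forall>i<n. \<forall>l<k. snd s x i l = emb (v l $ i))"

definition holds_input ::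
    "('a \<Rightarrow> complex) \<Rightarrow> nat \<Rightarrow> nat \<Rightarrow> 'a mat \<Rightarrow> (nat \<Rightarrow> 'a vec) \<Rightarrow> (nat \<Rightarrow> 'a vec) \<Rightarrow> real
       \<Rightarrow> store \<Rightarrow> bool" where
  "holds_input emb n k U a b \<eta> s \<longleftrightarrow>
     fst s ''n'' = n \<and> fst s ''k'' = k \<and>
     holds_matrix emb ''U'' n U s \<and>
     holds_vectors emb ''a'' n k a s \<and> holds_vectors emb ''b'' n k b s \<and>
     snd s ''eta'' 0 0 = complex_of_real \<eta>"

end

theory Submission
  imports Defs "Jordan_Normal_Form.Spectral_Radius"
begin

text \<open>
  With \<open>c = U\<^sup>* a\<close>, where \<open>a\<close> and \<open>b\<close> have the given vectors as columns, the exponent is the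
  skew-Hermitian matrix \<open>A = h (c b\<^sup>* - b c\<^sup>*)\<close> with \<open>h = - \<eta> / 2\<close>, whose rank is at most \<open>2 k\<close>.
  The eigenvectors \<open>P\<close> of the Gram matrix of \<open>V = [c | b]\<close> make the columns of \<open>V P\<close> orthogonal;
  after normalization these give \<open>Q\<close>, whose columns are orthonormal or zero, with \<open>Q Q\<^sup>* V = V\<close>. Hence
  \<open>A = Q S Q\<^sup>*\<close> for the skew-Hermitian matrix \<open>S = Q\<^sup>* A Q\<close> of size \<open>2 k\<close>. A unitary
  diagonalization \<open>S = R D R\<^sup>*\<close> and \<open>F = Q R\<close> yield \<open>exp A = 1 + F (exp D - 1) F\<^sup>*\<close>, so that
  \<open>U\<close> is changed by adding \<open>(U F) (exp D - 1) F\<^sup>*\<close>. No test for linear dependence of the columns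
  is needed, since division by zero yields zero.
\<close>

section \<open>Adjoints\<close>

text \<open>The columns of \<open>c\<close> and \<open>b\<close> may span any dimension up to
  \<open>2 k\<close>, and a basis found by pivoting would need tests for exact zeros. Diagonalizing
  the Gram matrix amounts to a singular value decomposition of \<open>V\<close> instead: its
  eigenvalues are the squared column norms of \<open>V P\<close>, and null directions become zero
  columns. The price is that \<open>Q\<^sup>* Q\<close> is only a projection. What remains,
  \<open>Q\<^sup>* Q Q\<^sup>* = Q\<^sup>*\<close>, is enough: columns of \<open>F\<close> with
  nonzero eigenvalue are orthonormal, and the others get the weight \<open>exp 0 - 1 = 0\<close>.
  The eigensolver promises nothing outside diagonalizable matrices, and unitary eigenvectors only
  for normal ones. Hence both matrices passed to it are Hermitian or skew-Hermitian, and the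
  spectral theorem supplies the existence that triggers the promise. The two eigenproblems cost
  \<open>k^3\<close>, the products of \<open>U\<close> with thin matrices and the final correction
  \<open>k n^2\<close>, the passage between bases \<open>n k^2\<close>. Real input goes through the
  same complex program; complex eigenvectors occur only in between.\<close>

lemma mult_mat_assoc:
  fixes A B C :: "'a::semiring_0 mat"
  assumes "dim_col A = dim_row B" "dim_col B = dim_row C"
  shows "(A * B) * C = A * (B * C)"
  by (rule assoc_mult_mat[of _ "dim_row A" "dim_col A" _ "dim_col B" _ "dim_col C"])
    (use assms in auto)

lemma dim_mat_adjoint [simp]:
  "dim_row (mat_adjoint A) = dim_col A" "dim_col (mat_adjoint A) = dim_row A"
  by (auto simp: mat_adjoint_def)

lemma index_mat_adjoint [simp]:
  "i < dim_col A \<Longrightarrow> j < dim_row A \<Longrightarrow> mat_adjoint A $$ (i, j) = conjugate (A $$ (j, i))"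
  by (simp add: mat_adjoint_def mat_of_rows_def)

lemma mat_adjoint_carrier [simp]:
  "A \<in> carrier_mat n m \<Longrightarrow> mat_adjoint A \<in> carrier_mat m n"
  by (rule carrier_matI) auto

lemma mat_adjoint_adjoint [simp]: "mat_adjoint (mat_adjoint A) = A"
  by (rule eq_matI) auto

text \<open>The simp rule \<open>index_mult_mat(1)\<close> turns an entry of a product into a scalar
  product of a row and a column. Entrywise arguments below delete it in favour of this plain
  sum.\<close>

lemma index_mult_mat_sum:
  fixes A B :: "'a::semiring_0 mat"
  assumes "i < dim_row A" "j < dim_col B" "dim_col A = dim_row B"
  shows "(A * B) $$ (i, j) = (\<Sum>l<dim_row B. A $$ (i, l) * B $$ (l, j))"
  using assms by (simp add: scalar_prod_def atLeast0LessThan)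

lemma mat_adjoint_mult:
  assumes "dim_col A = dim_row B"
  shows "mat_adjoint (A * B) = mat_adjoint B * mat_adjoint A"
  by (rule eq_matI)
    (use assms in \<open>auto simp: index_mult_mat_sum sum_conjugate conjugate_dist_mul mult.commute
      simp del: index_mult_mat(1)\<close>)

lemma mat_adjoint_minus:
  assumes "dim_row A = dim_row B" "dim_col A = dim_col B"
  shows "mat_adjoint (A - B) = mat_adjoint A - mat_adjoint B"
proof -
  have "conjugate (x - y) = conjugate x - conjugate y" for x y :: 'a
    using conjugate_dist_add[of x "- y"] by (simp add: conjugate_neg)
  then show ?thesis
    by (intro eq_matI) (use assms in auto)
qed

lemma mat_adjoint_smult: "mat_adjoint (c \<cdot>\<^sub>m A) = conjugate c \<cdot>\<^sub>m mat_adjoint A"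
  by (rule eq_matI) (auto simp: conjugate_dist_mul)

lemma mat_adjoint_map_of_real:
  "mat_adjoint (map_mat complex_of_real A) = map_mat complex_of_real (mat_adjoint A)"
  by (rule eq_matI) auto

section \<open>Unitary matrices\<close>

text \<open>The definition asks for one product only; the other one follows because a left inverse
  of a square matrix is also a right inverse.\<close>

lemma unitary_matD:
  assumes "unitary_mat n U"
  shows "dim_row U = n" "dim_col U = n"
    and "mat_adjoint U * U = 1\<^sub>m n" "U * mat_adjoint U = 1\<^sub>m n"
  using assms mat_mult_left_right_inverse[of "mat_adjoint U" n U]
  by (auto simp: unitary_mat_def)

lemma unitary_matI:
  assumes "dim_row U = n" "dim_col U = n" "mat_adjoint U * U = 1\<^sub>m n"
  shows "unitary_mat n U"
  using assms by (auto simp: unitary_mat_def)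

lemma unitary_mat_invertible:
  assumes "unitary_mat n U"
  shows "invertible_mat U"
  using unitary_matD[OF assms] unfolding invertible_mat_def inverts_mat_def
  by (auto intro!: exI[of _ "mat_adjoint U"])

lemma unitary_mat_mult:
  assumes U: "unitary_mat n U" and V: "unitary_mat n V"
  shows "unitary_mat n (U * V)"
proof (rule unitary_matI)
  note [simp] = unitary_matD[OF U] unitary_matD[OF V]
  show "dim_row (U * V) = n" "dim_col (U * V) = n" by auto
  have "mat_adjoint (U * V) * (U * V) = mat_adjoint V * ((mat_adjoint U * U) * V)"
    by (simp add: mat_adjoint_mult mult_mat_assoc del: assoc_mult_mat unitary_matD(3)[OF U])
  also have "\<dots> = 1\<^sub>m n"
    using left_mult_one_mat[of V n n] carrier_matI[of V n n] by simp
  finally show "mat_adjoint (U * V) * (U * V) = 1\<^sub>m n" .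
qed

section \<open>Gram matrices and normalization of orthogonal columns\<close>

lemma gram_diagonal_real:
  fixes W :: "complex mat"
  assumes "j < dim_col W"
  shows "(mat_adjoint W * W) $$ (j, j) = of_real (\<Sum>i<dim_row W. (cmod (W $$ (i, j)))\<^sup>2)"
  using assms
  by (simp add: index_mult_mat_sum complex_norm_square mult.commute
      del: index_mult_mat(1) of_real_power)

text \<open>Zero columns stay zero, because division by zero yields zero.\<close>

definition normalize_cols :: "complex mat \<Rightarrow> complex mat" where
  "normalize_cols W =
     mat (dim_row W) (dim_col W) (\<lambda>(i, j). W $$ (i, j) / csqrt ((mat_adjoint W * W) $$ (j, j)))"

lemma dim_normalize_cols [simp]:
  "dim_row (normalize_cols W) = dim_row W" "dim_col (normalize_cols W) = dim_col W"
  by (auto simp: normalize_cols_def)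

lemma csqrt_nonneg_of_real: "x \<ge> 0 \<Longrightarrow> csqrt (of_real x) = of_real (sqrt x)"
  by simp

context
  fixes W :: "complex mat" and s :: "nat \<Rightarrow> real"
  assumes diag: "diagonal_mat (mat_adjoint W * W)"
  defines "s \<equiv> \<lambda>j. sqrt (\<Sum>i<dim_row W. (cmod (W $$ (i, j)))\<^sup>2)"
begin

text \<open>A diagonal Gram entry is a nonnegative real, so its principal complex root is the
  Euclidean norm of the column.\<close>

lemma csqrt_gram: "j < dim_col W \<Longrightarrow> csqrt ((mat_adjoint W * W) $$ (j, j)) = of_real (s j)"
  unfolding s_def
  by (simp only: gram_diagonal_real csqrt_nonneg_of_real[OF sum_nonneg] zero_le_power2)

lemma gram_entry:
  assumes "i < dim_col W" "j < dim_col W"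
  shows "(\<Sum>l<dim_row W. cnj (W $$ (l, i)) * W $$ (l, j)) = (if i = j then of_real ((s j)\<^sup>2) else 0)"
proof -
  have "(mat_adjoint W * W) $$ (i, j) = (\<Sum>l<dim_row W. cnj (W $$ (l, i)) * W $$ (l, j))"
    using assms by (simp add: index_mult_mat_sum del: index_mult_mat(1))
  moreover have "(s j)\<^sup>2 = (\<Sum>i<dim_row W. (cmod (W $$ (i, j)))\<^sup>2)"
    unfolding s_def by (simp add: sum_nonneg)
  ultimately show ?thesis
    using diag assms gram_diagonal_real[of j W] by (auto simp: diagonal_mat_def)
qed

lemma s_eq_0: "j < dim_col W \<Longrightarrow> i < dim_row W \<Longrightarrow> s j = 0 \<Longrightarrow> W $$ (i, j) = 0"
  unfolding s_def by (simp add: sum_nonneg_eq_0_iff)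

lemma index_normalize_cols:
  "i < dim_row W \<Longrightarrow> j < dim_col W \<Longrightarrow> normalize_cols W $$ (i, j) = W $$ (i, j) / of_real (s j)"
  using csqrt_gram[of j] by (simp add: normalize_cols_def del: index_mult_mat(1))

text \<open>A zero column leaves a 0 on the diagonal, so this Gram matrix is a coordinate projection
  and is the identity only if all columns are nonzero.\<close>

lemma normalize_cols_gram:
  assumes "i < dim_col W" "j < dim_col W"
  shows "(mat_adjoint (normalize_cols W) * normalize_cols W) $$ (i, j) =
    (if i = j \<and> s j \<noteq> 0 then 1 else 0)"
proof -
  have "(mat_adjoint (normalize_cols W) * normalize_cols W) $$ (i, j) =
    (\<Sum>l<dim_row W. cnj (W $$ (l, i)) * W $$ (l, j)) / (of_real (s i) * of_real (s j))"
    using assms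
    by (simp add: index_mult_mat_sum index_normalize_cols sum_divide_distrib del: index_mult_mat(1))
  then show ?thesis
    using gram_entry[OF assms] by (auto simp: power2_eq_square)
qed

text \<open>The inner product is the diagonal matrix of column norms, which undoes the
  normalization. A column of norm zero is itself zero, so it is recovered as well.\<close>

lemma normalize_cols_proj:
  "normalize_cols W * (mat_adjoint (normalize_cols W) * W) = W" (is "?N * _ = _")
proof -
  have e: "(mat_adjoint ?N * W) $$ (l, j) = (if l = j then of_real (s j) else 0)"
    if "l < dim_col W" "j < dim_col W" for l j
  proof -
    have "(mat_adjoint ?N * W) $$ (l, j) =
        (\<Sum>i<dim_row W. cnj (W $$ (i, l)) * W $$ (i, j)) / of_real (s l)"
      using that
      by (simp add: index_mult_mat_sum index_normalize_cols sum_divide_distrib del: index_mult_mat(1))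
    then show ?thesis using gram_entry[OF that] by (auto simp: power2_eq_square)
  qed
  show ?thesis
  proof (rule eq_matI)
    fix i j assume ij: "i < dim_row W" "j < dim_col W"
    have "(?N * (mat_adjoint ?N * W)) $$ (i, j) =
        (\<Sum>l<dim_col W. ?N $$ (i, l) * (mat_adjoint ?N * W) $$ (l, j))"
      using ij by (subst index_mult_mat_sum) auto
    also have "\<dots> = (\<Sum>l<dim_col W. if l = j then ?N $$ (i, j) * of_real (s j) else 0)"
      using ij by (intro sum.cong) (auto simp: e simp del: index_mult_mat(1))
    also have "\<dots> = W $$ (i, j)"
      using ij s_eq_0[of j i] by (auto simp: index_normalize_cols)
    finally show "(?N * (mat_adjoint ?N * W)) $$ (i, j) = W $$ (i, j)" .
  qed auto
qed

end

section \<open>Spectral theorem\<close>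

text \<open>Complete \<open>v\<close> to a basis, orthogonalize with \<open>v\<close> kept as the
  head, and normalize. Normalization rescales \<open>v\<close>, but a multiple of an eigenvector
  serves equally well for the deflation below.\<close>

lemma unitary_mat_first_col:
  fixes v :: "complex vec"
  assumes v: "v \<in> carrier_vec n" and v0: "v \<noteq> 0\<^sub>v n"
  shows "\<exists>W c. unitary_mat n W \<and> col W 0 = c \<cdot>\<^sub>v v"
proof -
  interpret cof_vec_space n "TYPE(complex)" .
  define b where "b = basis_completion v"
  from basis_completion[OF v v0, folded b_def]
  have dist_b: "distinct b" and indep: "\<not> lin_dep (set b)" and b: "set b \<subseteq> carrier_vec n"
    and hdb: "hd b = v" and len_b: "length b = n" by auto
  have n: "n > 0" using v v0 by (cases n) auto
  define ws where "ws = gram_schmidt n b"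
  from hdb len_b n obtain vs where bv: "b = v # vs" by (cases b) auto
  from gram_schmidt_result[OF b dist_b indep refl, folded ws_def]
  have ws: "set ws \<subseteq> carrier_vec n" "corthogonal ws" "length ws = n" by (auto simp: len_b)
  from gram_schmidt_hd[OF v, of vs, folded bv] have hdws: "hd ws = v" unfolding ws_def .
  define V where "V = mat_of_cols n ws"
  have dV [simp]: "dim_row V = n" "dim_col V = n" using ws by (auto simp: V_def)
  have "corthogonal_mat V" using orthogonal_mat_of_cols ws unfolding V_def by blast
  then have diag: "diagonal_mat (mat_adjoint V * V)"
    and nz: "\<And>i. i < n \<Longrightarrow> (mat_adjoint V * V) $$ (i, i) \<noteq> 0"
    unfolding corthogonal_mat_def Let_def by auto
  define N where "N = normalize_cols V"
  have "unitary_mat n N"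
  proof (rule unitary_matI)
    show "mat_adjoint N * N = 1\<^sub>m n"
    proof (rule eq_matI)
      fix i j assume ij: "i < dim_row (1\<^sub>m n :: complex mat)" "j < dim_col (1\<^sub>m n :: complex mat)"
      \<comment> \<open>\<open>corthogonal_mat\<close> excludes zero columns, so every diagonal
        entry of the normalized Gram matrix is 1.\<close>
      moreover have "sqrt (\<Sum>i<dim_row V. (cmod (V $$ (i, j)))\<^sup>2) \<noteq> 0"
        using nz[of j] ij by (auto simp only: gram_diagonal_real dV index_one_mat real_sqrt_eq_0_iff of_real_0)
      ultimately show "(mat_adjoint N * N) $$ (i, j) = 1\<^sub>m n $$ (i, j)"
        using normalize_cols_gram[OF diag, of i j] unfolding N_def by auto
    qed (auto simp: N_def)
  qed (auto simp: N_def)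
  moreover have "col N 0 = (1 / csqrt ((mat_adjoint V * V) $$ (0, 0))) \<cdot>\<^sub>v v"
  proof (rule eq_vecI)
    fix i assume "i < dim_vec ((1 / csqrt ((mat_adjoint V * V) $$ (0, 0))) \<cdot>\<^sub>v v)"
    then have i: "i < n" using v by auto
    have "V $$ (i, 0) = v $ i"
      using i n hdws ws by (cases ws) (auto simp: V_def mat_of_cols_index)
    then show "col N 0 $ i = ((1 / csqrt ((mat_adjoint V * V) $$ (0, 0))) \<cdot>\<^sub>v v) $ i"
      using i n v by (simp add: N_def normalize_cols_def del: index_mult_mat(1))
  qed (use v in \<open>auto simp: N_def\<close>)
  ultimately show ?thesis by blast
qed

lemma mat_adjoint_four_block:
  assumes "A \<in> carrier_mat nr1 nc1" "B \<in> carrier_mat nr1 nc2"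
    "C \<in> carrier_mat nr2 nc1" "D \<in> carrier_mat nr2 nc2"
  shows "mat_adjoint (four_block_mat A B C D) =
    four_block_mat (mat_adjoint A) (mat_adjoint C) (mat_adjoint B) (mat_adjoint D)"
  by (rule eq_matI) (use assms in auto)

text \<open>Deflation: with an eigenvector as first column of a unitary \<open>W\<close>, the matrix
  \<open>W\<^sup>* A W\<close> has a trivial first column, by symmetry also a trivial first row, and
  a smaller Hermitian block to which induction applies. Its role is to show that an
  eigendecomposition exists, which the specification of an eigensolver presupposes.\<close>

theorem hermitian_diagonalization:
  fixes A :: "complex mat"
  assumes "A \<in> carrier_mat n n" "mat_adjoint A = A"
  shows "\<exists>P f. unitary_mat n P \<and> A * P = P * mat_diag n f"
  using assms
proof (induction n arbitrary: A)
  case 0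
  then show ?case
    by (intro exI[of _ "1\<^sub>m 0"] exI[of _ "\<lambda>_. 0"]) (auto simp: unitary_mat_def mat_diag_def intro!: eq_matI)
next
  case (Suc n)
  note A = Suc.prems
  have [simp]: "dim_row A = Suc n" "dim_col A = Suc n" using A by auto
  obtain e where "eigenvalue A e"
    using spectrum_non_empty[OF A(1)] by (auto simp: spectrum_def)
  then obtain v where v: "v \<in> carrier_vec (Suc n)" "v \<noteq> 0\<^sub>v (Suc n)" "A *\<^sub>v v = e \<cdot>\<^sub>v v"
    unfolding eigenvalue_def eigenvector_def by auto
  obtain W c where W: "unitary_mat (Suc n) W" and Wv: "col W 0 = c \<cdot>\<^sub>v v"
    using unitary_mat_first_col[OF v(1,2)] by blast
  note [simp] = unitary_matD(1,2)[OF W]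
  have ev: "A *\<^sub>v col W 0 = e \<cdot>\<^sub>v col W 0"
    unfolding Wv using v A(1) by (simp add: mult_mat_vec smult_smult_assoc mult.commute)
  define T where "T = mat_adjoint W * (A * W)"
  have [simp]: "dim_row T = Suc n" "dim_col T = Suc n" by (auto simp: T_def)
  have T_herm: "mat_adjoint T = T"
    unfolding T_def by (simp add: mat_adjoint_mult mult_mat_assoc A)
  have T0: "T $$ (i, 0) = (if i = 0 then e else 0)" if i: "i < Suc n" for i
  proof -
    have "col (A * W) 0 = e \<cdot>\<^sub>v col W 0"
      using ev by (subst col_mult2[of _ "Suc n" "Suc n" _ "Suc n"]) (auto simp: A)
    then have "T $$ (i, 0) = e * (mat_adjoint W * W) $$ (i, 0)"
      using i by (simp add: T_def)
    then show ?thesis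
      using i unfolding unitary_matD(3)[OF W] by auto
  qed
  have T0': "T $$ (0, i) = (if i = 0 then e else 0)" if i: "i < Suc n" for i
  proof -
    have "T $$ (0, i) = cnj (T $$ (i, 0))"
      using i by (subst T_herm[symmetric]) simp
    \<comment> \<open>The eigenvalue is a diagonal entry of a Hermitian matrix, hence real, so the
      first row mirrors the first column.\<close>
    moreover have "e = cnj e" using T0[of 0] calculation
      by (metis T_herm conjugate_complex_def dim_mat_adjoint(1) index_mat_adjoint \<open>dim_row T = Suc n\<close> zero_less_Suc)
    ultimately show ?thesis using T0[OF i] by auto
  qed
  define B where "B = mat n n (\<lambda>(i, j). T $$ (Suc i, Suc j))"
  have T_block: "T = four_block_mat (mat 1 1 (\<lambda>_. e)) (0\<^sub>m 1 n) (0\<^sub>m n 1) B"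
    by (rule eq_matI) (auto simp: T0 T0' B_def)
  have "mat_adjoint B = B"
  proof (rule eq_matI)
    fix i j assume ij: "i < dim_row B" "j < dim_col B"
    have "T $$ (Suc i, Suc j) = cnj (T $$ (Suc j, Suc i))"
      using ij by (subst T_herm[symmetric]) (simp add: B_def)
    then show "mat_adjoint B $$ (i, j) = B $$ (i, j)"
      using ij by (simp add: B_def)
  qed (auto simp: B_def)
  moreover have B: "B \<in> carrier_mat n n" by (simp add: B_def)
  ultimately obtain P f where P: "unitary_mat n P" and BP: "B * P = P * mat_diag n f"
    using Suc.IH by blast
  have Pc: "P \<in> carrier_mat n n" using P by (simp add: unitary_mat_def)
  define R where "R = four_block_mat (1\<^sub>m 1) (0\<^sub>m 1 n) (0\<^sub>m n 1) P"
  define g where "g i = (case i of 0 \<Rightarrow> e | Suc j \<Rightarrow> f j)" for i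
  have g_block: "mat_diag (Suc n) g =
      four_block_mat (mat 1 1 (\<lambda>_. e)) (0\<^sub>m 1 n) (0\<^sub>m n 1) (mat_diag n f)"
    by (rule eq_matI) (auto simp: mat_diag_def g_def split: nat.split)
  have R: "unitary_mat (Suc n) R"
  proof (rule unitary_matI)
    have "mat_adjoint R = four_block_mat (1\<^sub>m 1) (0\<^sub>m 1 n) (0\<^sub>m n 1) (mat_adjoint P)"
      unfolding R_def
      by (subst mat_adjoint_four_block[OF _ _ _ Pc])
        (auto simp: unitary_matD(1,2)[OF P]
          intro!: arg_cong2[where f = "\<lambda>x y. four_block_mat _ x y _"] eq_matI)
    then show "mat_adjoint R * R = 1\<^sub>m (Suc n)"
      unfolding R_def using Pc unitary_matD(3)[OF P]
      by (simp add: mult_four_block_mat[of _ 1 1 _ n _ n _ _ 1 _ n])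
  qed (use Pc in \<open>auto simp: R_def\<close>)
  note [simp] = unitary_matD(1,2)[OF R]
  have TR: "T * R = R * mat_diag (Suc n) g"
    unfolding T_block R_def g_block using Pc B BP
    by (simp add: mult_four_block_mat[of _ 1 1 _ n _ n _ _ 1 _ n] mat_diag_dim
        left_mult_one_mat[of _ 1 1] right_mult_one_mat[of _ 1 1]
        left_mult_zero_mat[of "mat_diag n f" n n] left_add_zero_mat[of _ 1 n])
  have "A * (W * R) = (W * mat_adjoint W) * (A * W * R)"
    unfolding unitary_matD(4)[OF W] by (simp add: mult_mat_assoc left_mult_one_mat'  del: assoc_mult_mat)
  also have "\<dots> = W * (T * R)"
    by (simp add: T_def mult_mat_assoc)
  also have "\<dots> = W * R * mat_diag (Suc n) g"
    unfolding TR by (simp add: mult_mat_assoc mat_diag_def)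
  finally have "A * (W * R) = W * R * mat_diag (Suc n) g" .
  then show ?case using unitary_mat_mult[OF W R] by blast
qed

lemma is_eigendecompositionI:
  assumes "unitary_mat n P" "A * P = P * mat_diag n f"
  shows "is_eigendecomposition n A P (vec n f)"
proof -
  have "mat_diag n f = mat_diag n (\<lambda>i. vec n f $ i)"
    by (rule eq_matI) (auto simp: mat_diag_def)
  then show ?thesis
    using assms unitary_mat_invertible[OF assms(1)]
    by (auto simp: is_eigendecomposition_def unitary_mat_def)
qed

text \<open>Existence comes from the spectral theorem and unitarity from the clause on normal
  matrices. The solver may return another decomposition than the one constructed, so only its own
  answer is described.\<close>

lemma eigensolver_hermitian:
  assumes E: "is_eigensolver E" and A: "A \<in> carrier_mat n n" and herm: "mat_adjoint A = A"
    and EA: "E A = (P, d)"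
  shows "unitary_mat n P" "A * P = P * mat_diag n (($) d)"
proof -
  obtain P' f where "unitary_mat n P'" "A * P' = P' * mat_diag n f"
    using hermitian_diagonalization[OF A herm] by blast
  then have "\<exists>P d. is_eigendecomposition n A P d" using is_eigendecompositionI by blast
  then have "is_eigendecomposition n A P d"
    using E A EA unfolding is_eigensolver_def by (metis fst_conv snd_conv)
  then show "unitary_mat n P" "A * P = P * mat_diag n (($) d)"
    using herm by (auto simp: is_eigendecomposition_def)
qed

text \<open>\<open>\<i> \<cdot>\<^sub>m A\<close> is Hermitian, and multiplying its eigenvalues by
  \<open>- \<i>\<close> gives a diagonalization of \<open>A\<close> with the same
  eigenvectors.\<close>

lemma eigensolver_skew_hermitian:
  assumes E: "is_eigensolver E" and A: "A \<in> carrier_mat n n" and skew: "mat_adjoint A = - A"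
    and EA: "E A = (P, d)"
  shows "unitary_mat n P" "A * P = P * mat_diag n (($) d)"
proof -
  have [simp]: "dim_row A = n" "dim_col A = n" using A by auto
  have "mat_adjoint (\<i> \<cdot>\<^sub>m A) = \<i> \<cdot>\<^sub>m A"
    unfolding mat_adjoint_smult skew by (rule eq_matI) auto
  then obtain P' f where P': "unitary_mat n P'" and eq: "(\<i> \<cdot>\<^sub>m A) * P' = P' * mat_diag n f"
    using hermitian_diagonalization[of "\<i> \<cdot>\<^sub>m A" n] A by auto
  note [simp] = unitary_matD(1,2)[OF P']
  have P'c: "P' \<in> carrier_mat n n" by auto
  have "A * P' = - \<i> \<cdot>\<^sub>m ((\<i> \<cdot>\<^sub>m A) * P')"
    using mult_smult_assoc_mat[OF A P'c, of \<i>] by (intro eq_matI) (auto simp: smult_smult_assoc)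
  also have "\<dots> = P' * mat_diag n (\<lambda>i. - \<i> * f i)"
    unfolding eq by (subst (1 2) mat_diag_mult_right[OF P'c]) (auto intro!: eq_matI)
  finally have "\<exists>P d. is_eigendecomposition n A P d" using is_eigendecompositionI P' by blast
  then have "is_eigendecomposition n A P d"
    using E A EA unfolding is_eigensolver_def by (metis fst_conv snd_conv)
  moreover have "A * mat_adjoint A = mat_adjoint A * A"
    unfolding skew using A by auto
  ultimately show "unitary_mat n P" "A * P = P * mat_diag n (($) d)"
    by (auto simp: is_eigendecomposition_def)
qed

section \<open>Projection onto the tangent space\<close>

lemma mat_trace_mult_commute:
  fixes A B :: "'a::comm_semiring_0 mat"
  assumes "dim_row A = dim_col B" "dim_col A = dim_row B"
  shows "mat_trace (A * B) = mat_trace (B * A)"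
proof -
  have "mat_trace (A * B) = (\<Sum>i<dim_row A. \<Sum>l<dim_row B. A $$ (i, l) * B $$ (l, i))"
    using assms by (simp add: mat_trace_def index_mult_mat_sum del: index_mult_mat(1))
  also have "\<dots> = (\<Sum>l<dim_row B. \<Sum>i<dim_row A. B $$ (l, i) * A $$ (i, l))"
    by (subst sum.swap) (simp add: mult.commute)
  also have "\<dots> = mat_trace (B * A)"
    using assms by (simp add: mat_trace_def index_mult_mat_sum del: index_mult_mat(1))
  finally show ?thesis .
qed

lemma mat_trace_add:
  assumes "dim_row A = n" "dim_col A = n" "dim_row B = n" "dim_col B = n"
  shows "mat_trace (A + B) = mat_trace A + mat_trace B"
  using assms by (simp add: mat_trace_def sum.distrib)

lemma mat_trace_minus:
  fixes A B :: "'a::ab_group_add mat"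
  assumes "dim_row A = n" "dim_col A = n" "dim_row B = n" "dim_col B = n"
  shows "mat_trace (A - B) = mat_trace A - mat_trace B"
  using assms by (simp add: mat_trace_def sum_subtractf)

lemma mat_trace_uminus:
  fixes A :: "'a::ab_group_add mat"
  assumes "dim_row A = n" "dim_col A = n"
  shows "mat_trace (- A) = - mat_trace A"
  using assms by (simp add: mat_trace_def sum_negf)

lemma mat_trace_smult:
  fixes A :: "'a::comm_semiring_0 mat"
  assumes "dim_row A = dim_col A"
  shows "mat_trace (c \<cdot>\<^sub>m A) = c * mat_trace A"
  using assms by (simp add: mat_trace_def sum_distrib_left)

lemma mat_trace_adjoint:
  fixes A :: "'a::conjugatable_field mat"
  assumes "dim_row A = dim_col A"
  shows "mat_trace (mat_adjoint A) = conjugate (mat_trace A)"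
  using assms by (simp add: mat_trace_def sum_conjugate)

lemma conjugate_one [simp]: "conjugate (1 :: 'a::conjugatable_field) = 1"
  using conjugate_dist_mul[of 1 "1 :: 'a"] by simp

lemma conjugate_half [simp]:
  "conjugate (1 / 2 :: 'a::{conjugatable_field, real_normed_field}) = 1 / 2"
proof -
  have "conjugate (2 :: 'a) = 2"
    using conjugate_dist_add[of 1 "1 :: 'a"] by simp
  moreover have "conjugate (1 / 2 :: 'a) * conjugate 2 = 1"
    unfolding conjugate_dist_mul[symmetric] by simp
  ultimately show ?thesis by (simp add: field_simps)
qed

text \<open>The classes \<open>conjugatable_field\<close> and \<open>real_inner\<close> do not
  relate conjugation to the inner product. The premise \<open>pos\<close> carries this link and is
  discharged for each scalar type; it makes \<open>re_trace_inner D D\<close> a sum of terms that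
  are positive at nonzero entries.\<close>

lemma re_trace_inner_eq_0D:
  fixes D :: "'a::{conjugatable_field, real_inner} mat"
  assumes pos: "\<And>z::'a. z \<noteq> 0 \<Longrightarrow> inner 1 (conjugate z * z) > 0"
    and D: "D \<in> carrier_mat n n" and z: "re_trace_inner D D = 0"
  shows "D = 0\<^sub>m n n"
proof -
  have [simp]: "dim_row D = n" "dim_col D = n" using D by auto
  have nonneg: "inner 1 (conjugate z * z) \<ge> 0" for z :: 'a
    using pos[of z] by (cases "z = 0") auto
  have "(\<Sum>j<n. \<Sum>i<n. inner 1 (conjugate (D $$ (i, j)) * D $$ (i, j))) = 0"
    using z by (simp add: re_trace_inner_def mat_trace_def index_mult_mat_sum inner_sum_right
        del: index_mult_mat(1))
  then have "inner 1 (conjugate (D $$ (i, j)) * D $$ (i, j)) = 0" if "i < n" "j < n" for i j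
    using that by (auto simp: sum_nonneg_eq_0_iff sum_nonneg nonneg)
  then show ?thesis
    using pos by (intro eq_matI) (auto, fastforce)
qed

text \<open>Left multiplication by \<open>U\<^sup>*\<close> turns tangent vectors into
  skew-Hermitian matrices, the claimed projection into the skew-Hermitian part of
  \<open>U\<^sup>* X\<close> and the remainder into the Hermitian part. These parts are orthogonal
  for the real trace product. Since \<open>tangent_proj\<close> is a definite description,
  uniqueness has to be shown too.\<close>

lemma tangent_proj_eq:
  fixes U X :: "'a::{conjugatable_field, real_inner, real_normed_field} mat"
  assumes conj: "\<And>z::'a. inner 1 (conjugate z) = inner 1 z"
    and pos: "\<And>z::'a. z \<noteq> 0 \<Longrightarrow> inner 1 (conjugate z * z) > 0"
    and U: "unitary_mat n U" and X: "X \<in> carrier_mat n n"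
  shows "tangent_proj U X = (1 / 2) \<cdot>\<^sub>m (X - U * mat_adjoint X * U)"
proof -
  note UU = unitary_matD(3,4)[OF U]
  have [simp]: "dim_row U = n" "dim_col U = n" "dim_row X = n" "dim_col X = n"
    using X unitary_matD[OF U] by auto
  define Z where "Z = U * (mat_adjoint X * U)"
  define P where "P = (1 / 2) \<cdot>\<^sub>m (X - Z)"
  have [simp]: "dim_row Z = n" "dim_col Z = n" "dim_row P = n" "dim_col P = n"
    by (auto simp: Z_def P_def)
  have UZ: "mat_adjoint U * Z = mat_adjoint X * U"
  proof -
    have "mat_adjoint U * Z = (mat_adjoint U * U) * (mat_adjoint X * U)"
      unfolding Z_def by (simp add: mult_mat_assoc)
    then show ?thesis unfolding UU by (subst (asm) left_mult_one_mat[of _ n n]) auto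
  qed
  have ZU: "mat_adjoint Z * U = mat_adjoint U * X"
  proof -
    have "mat_adjoint Z * U = mat_adjoint (mat_adjoint U * Z)"
      by (simp add: mat_adjoint_mult)
    then show ?thesis unfolding UZ by (simp add: mat_adjoint_mult)
  qed
  have P_tan: "P \<in> tangent_space U"
  proof -
    have "mat_adjoint U * P = (1 / 2) \<cdot>\<^sub>m (mat_adjoint U * X - mat_adjoint X * U)"
      unfolding P_def UZ[symmetric]
      by (subst mult_smult_distrib[of _ n n _ n], auto simp: carrier_matI)
        (subst mult_minus_distrib_mat[of _ n n _ n], auto simp: carrier_matI)
    moreover have "mat_adjoint P * U = (1 / 2) \<cdot>\<^sub>m (mat_adjoint X * U - mat_adjoint U * X)"
      unfolding P_def ZU[symmetric] mat_adjoint_smult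
      by (subst mult_smult_assoc_mat[of _ n n _ n], auto simp: carrier_matI mat_adjoint_minus)
        (subst minus_mult_distrib_mat[of _ n n _ _ n], auto simp: carrier_matI)
    ultimately have "mat_adjoint U * P + mat_adjoint P * U = 0\<^sub>m n n"
      by (intro eq_matI) (auto simp: algebra_simps simp del: index_mult_mat(1))
    then show ?thesis by (auto simp: tangent_space_def intro: carrier_matI)
  qed
  have half: "inner 1 (1 / 2 * w :: 'a) = inner 1 w / 2" for w
  proof -
    have half_scaleR: "1 / 2 * w = scaleR (1 / 2) w" by (simp add: scaleR_conv_of_real)
    show ?thesis unfolding half_scaleR inner_scaleR_right by simp
  qed
  have P_orth: "re_trace_inner Y (X - P) = 0" if Y: "Y \<in> tangent_space U" for Y
  proof -
    have [simp]: "dim_row Y = n" "dim_col Y = n"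
      and tan: "mat_adjoint U * Y + mat_adjoint Y * U = 0\<^sub>m n n"
      using Y by (auto simp: tangent_space_def)
    have YU: "mat_adjoint Y * U = - (mat_adjoint U * Y)"
    proof (rule eq_matI)
      fix i j assume "i < dim_row (- (mat_adjoint U * Y))" "j < dim_col (- (mat_adjoint U * Y))"
      then have ij: "i < n" "j < n" by auto
      have "(mat_adjoint U * Y + mat_adjoint Y * U) $$ (i, j) = 0"
        unfolding tan using ij by simp
      then show "(mat_adjoint Y * U) $$ (i, j) = (- (mat_adjoint U * Y)) $$ (i, j)"
        using ij by (simp add: eq_neg_iff_add_eq_0 add.commute del: index_mult_mat(1))
    qed auto
    have "X - P = (1 / 2) \<cdot>\<^sub>m (X + Z)"
      by (rule eq_matI) (auto simp: P_def field_simps)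
    then have "mat_trace (mat_adjoint Y * (X - P)) =
        1 / 2 * (mat_trace (mat_adjoint Y * X) + mat_trace (mat_adjoint Y * Z))"
      by (simp add: mult_smult_distrib[of _ n n _ n] mat_trace_smult carrier_matI
          mult_add_distrib_mat[of _ n n _ n] mat_trace_add[of _ n])
    \<comment> \<open>Tangency replaces \<open>Y\<^sup>* U\<close> by its negative adjoint and the
      trace is cyclic. The two traces are therefore negative conjugates of each other, and their sum
      has no real part.\<close>
    moreover have "mat_trace (mat_adjoint Y * Z) = - conjugate (mat_trace (mat_adjoint Y * X))"
    proof -
      have "mat_adjoint Y * Z = (mat_adjoint Y * U) * (mat_adjoint X * U)"
        unfolding Z_def by (simp add: mult_mat_assoc)
      also have "\<dots> = - ((mat_adjoint U * Y) * (mat_adjoint X * U))"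
        unfolding YU by (rule uminus_mult_left_mat) auto
      also have "(mat_adjoint U * Y) * (mat_adjoint X * U) = (mat_adjoint U * Y * mat_adjoint X) * U"
        by (simp add: mult_mat_assoc)
      finally have "mat_trace (mat_adjoint Y * Z) = - mat_trace ((mat_adjoint U * Y * mat_adjoint X) * U)"
        by (simp add: mat_trace_uminus)
      also have "mat_trace ((mat_adjoint U * Y * mat_adjoint X) * U) =
          mat_trace (U * (mat_adjoint U * Y * mat_adjoint X))"
        by (rule mat_trace_mult_commute) auto
      also have "U * (mat_adjoint U * Y * mat_adjoint X) = (U * mat_adjoint U) * (Y * mat_adjoint X)"
        by (simp add: mult_mat_assoc)
      also have "\<dots> = Y * mat_adjoint X"
        unfolding UU by (rule left_mult_one_mat[of _ n n]) auto
      also have "mat_trace (Y * mat_adjoint X) = mat_trace (mat_adjoint (mat_adjoint Y * X))"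
        by (simp add: mat_adjoint_mult mat_trace_mult_commute)
      also have "\<dots> = conjugate (mat_trace (mat_adjoint Y * X))"
        by (rule mat_trace_adjoint) auto
      finally show ?thesis .
    qed
    ultimately show ?thesis
      by (simp add: re_trace_inner_def half inner_diff_right conj del: times_divide_eq_left)
  qed
  have unique: "P' = P" if P': "P' \<in> tangent_space U"
    and orth: "\<forall>Y\<in>tangent_space U. re_trace_inner Y (X - P') = 0" for P'
  proof -
    have [simp]: "dim_row P' = n" "dim_col P' = n"
      using P' by (auto simp: tangent_space_def)
    define D where "D = P - P'"
    have [simp]: "dim_row D = n" "dim_col D = n" by (auto simp: D_def)
    have "mat_adjoint U * D + mat_adjoint D * U =
        (mat_adjoint U * P + mat_adjoint P * U) - (mat_adjoint U * P' + mat_adjoint P' * U)"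
      unfolding D_def
      by (simp add: mat_adjoint_minus mult_minus_distrib_mat[of _ n n _ n]
          minus_mult_distrib_mat[of _ n n _ _ n] carrier_matI)
        (rule eq_matI, auto simp del: index_mult_mat(1))
    then have D: "D \<in> tangent_space U"
      using P_tan P' by (auto simp: tangent_space_def intro!: carrier_matI)
    \<comment> \<open>A difference of two remainders, each orthogonal to the tangent vector
      \<open>D\<close>; so \<open>D\<close> is orthogonal to itself.\<close>
    have "D = (X - P') - (X - P)"
      unfolding D_def by (rule eq_matI) auto
    then have "mat_adjoint D * D = mat_adjoint D * (X - P') - mat_adjoint D * (X - P)"
      by (metis mult_minus_distrib_mat[of "mat_adjoint D" n n "X - P'" n "X - P"]
          carrier_matI dim_mat_adjoint \<open>dim_row D = n\<close> \<open>dim_col D = n\<close> \<open>dim_row P = n\<close>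
          \<open>dim_col P = n\<close> \<open>dim_row P' = n\<close> \<open>dim_col P' = n\<close> index_minus_mat(2,3))
    then have "re_trace_inner D D = re_trace_inner D (X - P') - re_trace_inner D (X - P)"
      unfolding re_trace_inner_def by (simp add: mat_trace_minus[of _ n] inner_diff_right)
    then have "re_trace_inner D D = 0" using D orth P_orth by simp
    then have "D = 0\<^sub>m n n" by (intro re_trace_inner_eq_0D[OF pos]) (auto intro: carrier_matI)
    show "P' = P"
    proof (rule eq_matI)
      fix i j assume "i < dim_row P" "j < dim_col P"
      then have "D $$ (i, j) = 0" using \<open>D = 0\<^sub>m n n\<close> by simp
      then show "P' $$ (i, j) = P $$ (i, j)"
        using \<open>i < dim_row P\<close> \<open>j < dim_col P\<close> by (simp add: D_def)
    qed auto
  qed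
  have "tangent_proj U X = P"
    unfolding tangent_proj_def by (rule the_equality) (use P_tan P_orth unique in blast)+
  then show ?thesis by (simp add: P_def Z_def mult_mat_assoc)
qed

lemma tangent_proj_complex:
  fixes U :: "complex mat"
  assumes "unitary_mat n U" "X \<in> carrier_mat n n"
  shows "tangent_proj U X = (1 / 2) \<cdot>\<^sub>m (X - U * mat_adjoint X * U)"
proof (rule tangent_proj_eq[OF _ _ assms])
  show "inner 1 (conjugate z * z) > 0" if "z \<noteq> 0" for z :: complex
    using that by (auto simp: inner_complex_def sum_squares_gt_zero_iff complex_eq_iff)
qed (simp add: inner_complex_def)

lemma tangent_proj_real:
  fixes U :: "real mat"
  assumes "unitary_mat n U" "X \<in> carrier_mat n n"
  shows "tangent_proj U X = (1 / 2) \<cdot>\<^sub>m (X - U * mat_adjoint X * U)"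
  by (rule tangent_proj_eq[OF _ _ assms]) (auto simp: zero_less_mult_iff)

section \<open>The matrix exponential\<close>

text \<open>With \<open>c\<close> the sum of the norms of all entries, every column sum is at most
  \<open>c\<close>, so the entries of the \<open>m\<close>-th power are bounded by
  \<open>c ^ m\<close> and the scalar exponential series dominates. Summability is what allows the
  real series to be embedded into the complex numbers.\<close>

lemma mat_exp_summable:
  fixes A :: "'a::{real_normed_field, banach} mat"
  assumes A: "A \<in> carrier_mat n n" and ij: "i < n" "j < n"
  shows "summable (\<lambda>m. (A ^\<^sub>m m) $$ (i, j) / fact m)"
proof -
  define c where "c = (\<Sum>p<n. \<Sum>q<n. norm (A $$ (p, q)))"
  have dims: "dim_row (A ^\<^sub>m m) = n" "dim_col (A ^\<^sub>m m) = n" for m using A by auto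
  have c0: "c \<ge> 0" by (auto simp: c_def intro!: sum_nonneg)
  have col: "(\<Sum>l<n. norm (A $$ (l, j))) \<le> c" if "j < n" for j
    unfolding c_def by (intro sum_mono member_le_sum[of j "{..<n}" "\<lambda>q. norm (A $$ (_, q))"]) (use that in auto)
  have "norm ((A ^\<^sub>m m) $$ (i, j)) \<le> c ^ m" if "i < n" "j < n" for m i j
    using that
  proof (induction m arbitrary: i j)
    case 0
    then show ?case using A by simp
  next
    case (Suc m)
    have "norm ((A ^\<^sub>m Suc m) $$ (i, j)) = norm (\<Sum>l<n. (A ^\<^sub>m m) $$ (i, l) * A $$ (l, j))"
      using Suc.prems A dims by (simp add: index_mult_mat_sum del: index_mult_mat(1))
    also have "\<dots> \<le> (\<Sum>l<n. c ^ m * norm (A $$ (l, j)))"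
      using Suc by (intro order.trans[OF norm_sum] sum_mono) (auto simp: norm_mult intro!: mult_right_mono)
    also have "\<dots> \<le> c ^ m * c"
      unfolding sum_distrib_left[symmetric] using c0 col[OF Suc.prems(2)] by (intro mult_left_mono) auto
    finally show ?case by (simp add: mult.commute)
  qed
  then have "norm ((A ^\<^sub>m m) $$ (i, j) / fact m) \<le> inverse (fact m) * c ^ m" for m
    using ij by (simp add: norm_divide divide_simps norm_fact)
  then show ?thesis
    by (intro summable_comparison_test'[OF summable_exp[of c]]) auto
qed

lemma mat_exp_map_of_real:
  assumes A: "A \<in> carrier_mat n n"
  shows "mat_exp (map_mat complex_of_real A) = map_mat complex_of_real (mat_exp A)"
proof (rule eq_matI)
  fix i j
  assume "i < dim_row (map_mat complex_of_real (mat_exp A))" "j < dim_col (map_mat complex_of_real (mat_exp A))"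
  then have ij: "i < n" "j < n" using A by (auto simp: mat_exp_def)
  have pow: "map_mat complex_of_real A ^\<^sub>m m = map_mat complex_of_real (A ^\<^sub>m m)" for m
    by (rule of_real_hom.mat_hom_pow[OF A, symmetric])
  have dims: "dim_row (A ^\<^sub>m m) = n" "dim_col (A ^\<^sub>m m) = n" for m using A by auto
  have "(\<lambda>m. (map_mat complex_of_real A ^\<^sub>m m) $$ (i, j) / fact m) =
      (\<lambda>m. complex_of_real ((A ^\<^sub>m m) $$ (i, j) / fact m))"
    using ij dims by (simp add: pow)
  then show "mat_exp (map_mat complex_of_real A) $$ (i, j) = map_mat complex_of_real (mat_exp A) $$ (i, j)"
    using ij A suminf_of_real[OF mat_exp_summable[OF A ij], where 'a = complex]
    by (simp add: mat_exp_def)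
qed (use A in \<open>auto simp: mat_exp_def\<close>)

text \<open>The columns of \<open>F\<close> need not be orthonormal: \<open>proj\<close> makes
  \<open>F\<^sup>* F\<close> act as the identity only where \<open>f\<close> is nonzero. All
  positive powers then collapse to \<open>F\<close> times a diagonal power times
  \<open>F\<^sup>*\<close>, but the power 0 is the identity of size \<open>n\<close>. Separating it
  produces \<open>exp (f l) - 1\<close>, which vanishes exactly where \<open>proj\<close> says
  nothing because \<open>f l\<close> is 0.\<close>

lemma mat_exp_diagonal_factor:
  fixes F :: "complex mat" and f :: "nat \<Rightarrow> complex"
  assumes F: "F \<in> carrier_mat n m"
    and proj: "mat_adjoint F * (F * mat_diag m f) = mat_diag m f"
  shows "mat_exp (F * mat_diag m f * mat_adjoint F) =
    1\<^sub>m n + F * mat m n (\<lambda>(l, j). (exp (f l) - 1) * cnj (F $$ (j, l)))"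
proof -
  define A where "A = F * mat_diag m f * mat_adjoint F"
  define D where "D p = mat_diag m (\<lambda>l. f l ^ p)" for p
  have [simp]: "dim_row F = n" "dim_col F = m" "dim_row (D p) = m" "dim_col (D p) = m"
    "dim_row (mat_diag m f) = m" "dim_col (mat_diag m f) = m" for p
    using F by (auto simp: D_def mat_diag_def)
  have A: "A \<in> carrier_mat n n" by (auto simp: A_def)
  have [simp]: "dim_row A = n" "dim_col A = n" using A by auto
  have step: "mat_adjoint F * A = mat_diag m f * mat_adjoint F"
    using arg_cong[OF proj, of "\<lambda>M. M * mat_adjoint F"] by (simp add: A_def mult_mat_assoc)
  have pow: "A ^\<^sub>m Suc p = F * (D (Suc p) * mat_adjoint F)" for p
  proof (induction p)
    case 0
    have "1\<^sub>m n * A = A" using A by (rule left_mult_one_mat)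
    then show ?case by (simp add: D_def A_def mult_mat_assoc)
  next
    case (Suc p)
    have "A ^\<^sub>m Suc (Suc p) = F * (D (Suc p) * mat_adjoint F) * A"
      unfolding Suc.IH[symmetric] by simp
    also have "\<dots> = F * ((D (Suc p) * mat_diag m f) * mat_adjoint F)"
      by (simp add: mult_mat_assoc step)
    also have "D (Suc p) * mat_diag m f = D (Suc (Suc p))"
      by (simp add: D_def mult.commute)
    finally show ?case .
  qed
  have sums: "(\<lambda>p. (A ^\<^sub>m p) $$ (i, j) / fact p) sums
      ((if i = j then 1 else 0) + (\<Sum>l<m. F $$ (i, l) * ((exp (f l) - 1) * cnj (F $$ (j, l)))))"
    if ij: "i < n" "j < n" for i j
  proof -
    \<comment> \<open>The term at \<open>p = 0\<close> is taken out of each scalar series, since the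
      identity matrix already accounts for it.\<close>
    define g where "g l p = (if p = 0 then 0 else F $$ (i, l) * cnj (F $$ (j, l)) * (f l ^ p / fact p))" for l p
    have "(A ^\<^sub>m p) $$ (i, j) / fact p = (if p = 0 then if i = j then 1 else 0 else 0) + (\<Sum>l<m. g l p)" for p
    proof (cases p)
      case 0
      then show ?thesis using ij A by (simp add: g_def)
    next
      case (Suc q)
      have "D p * mat_adjoint F = mat m n (\<lambda>(l, j). f l ^ p * mat_adjoint F $$ (l, j))"
        unfolding D_def by (rule mat_diag_mult_left) auto
      then have "(A ^\<^sub>m p) $$ (i, j) = (\<Sum>l<m. F $$ (i, l) * (f l ^ p * cnj (F $$ (j, l))))"
        unfolding Suc pow using ij by (subst index_mult_mat_sum) auto
      then show ?thesis
        using Suc by (simp add: g_def sum_divide_distrib mult_ac)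
    qed
    moreover have "g l sums (F $$ (i, l) * ((exp (f l) - 1) * cnj (F $$ (j, l))))" for l
    proof -
      have "(\<lambda>p. f l ^ p / fact p) sums exp (f l)"
        using exp_converges[of "f l"] by (simp add: scaleR_conv_of_real divide_inverse mult.commute)
      from sums_diff[OF this sums_single[of 0 "\<lambda>_. 1"]]
      have "(\<lambda>p. if p = 0 then 0 else f l ^ p / fact p) sums (exp (f l) - 1)"
        by (rule sums_cong[THEN iffD1, rotated]) auto
      from sums_mult[OF this, of "F $$ (i, l) * cnj (F $$ (j, l))"]
      show ?thesis unfolding g_def by (simp add: mult_ac if_distrib cong: if_cong)
    qed
    ultimately show ?thesis
      using sums_add[OF sums_single[of 0 "\<lambda>_. if i = j then 1 else (0::complex)"] sums_sum[of "{..<m}" g]]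
      by simp
  qed
  have "mat_exp A = 1\<^sub>m n + F * mat m n (\<lambda>(l, j). (exp (f l) - 1) * cnj (F $$ (j, l)))"
  proof (rule eq_matI)
    fix i j
    assume "i < dim_row (1\<^sub>m n + F * mat m n (\<lambda>(l, j). (exp (f l) - 1) * cnj (F $$ (j, l))))"
      "j < dim_col (1\<^sub>m n + F * mat m n (\<lambda>(l, j). (exp (f l) - 1) * cnj (F $$ (j, l))))"
    then have ij: "i < n" "j < n" by auto
    then show "mat_exp A $$ (i, j) =
        (1\<^sub>m n + F * mat m n (\<lambda>(l, j). (exp (f l) - 1) * cnj (F $$ (j, l)))) $$ (i, j)"
      using sums_unique[OF sums[OF ij], symmetric]
      by (simp add: mat_exp_def index_mult_mat_sum del: index_mult_mat(1))
  qed (auto simp: mat_exp_def)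
  then show ?thesis by (simp add: A_def)
qed

section \<open>The update of low rank\<close>

text \<open>The eigenvalues \<open>d\<close> are the diagonal of the Gram matrix of
  \<open>V P\<close>, so dividing by their roots is exactly \<open>normalize_cols\<close>. Thus
  \<open>Q\<close> holds left singular vectors of \<open>V\<close>, and \<open>Q Q\<^sup>*\<close>
  projects onto its column space.\<close>

lemma normalize_gram_eigenvectors:
  fixes V :: "complex mat"
  assumes V: "V \<in> carrier_mat n m" and E: "is_eigensolver E"
    and EV: "E (mat_adjoint V * V) = (P, d)"
    and Q: "Q = mat n m (\<lambda>(i, j). (V * P) $$ (i, j) / csqrt (d $ j))"
  shows "Q * (mat_adjoint Q * V) = V" "mat_adjoint Q * (Q * mat_adjoint Q) = mat_adjoint Q"
proof -
  have [simp]: "dim_row V = n" "dim_col V = m" using V by auto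
  have "mat_adjoint V * V \<in> carrier_mat m m" by (rule carrier_matI) auto
  note PD = eigensolver_hermitian[OF E this _ EV]
  have P: "unitary_mat m P" and eig: "(mat_adjoint V * V) * P = P * mat_diag m (($) d)"
    using PD by (simp_all add: mat_adjoint_mult)
  note [simp] = unitary_matD(1,2)[OF P]
  define W where "W = V * P"
  have [simp]: "dim_row W = n" "dim_col W = m" by (auto simp: W_def)
  have gram: "mat_adjoint W * W = mat_diag m (($) d)"
  proof -
    have "mat_adjoint W * W = mat_adjoint P * ((mat_adjoint V * V) * P)"
      by (simp add: W_def mat_adjoint_mult mult_mat_assoc)
    also have "\<dots> = (mat_adjoint P * P) * mat_diag m (($) d)"
      unfolding eig by (simp add: mult_mat_assoc mat_diag_def)
    finally show ?thesis unfolding unitary_matD(3)[OF P] left_mult_one_mat[OF mat_diag_dim] .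
  qed
  then have diag: "diagonal_mat (mat_adjoint W * W)"
    by (auto simp: diagonal_mat_def mat_diag_def)
  have QN: "Q = normalize_cols W"
    unfolding Q normalize_cols_def gram by (rule eq_matI) (auto simp: W_def mat_diag_def)
  have [simp]: "dim_row Q = n" "dim_col Q = m" by (auto simp: Q)
  have QW: "Q * (mat_adjoint Q * W) = W"
    unfolding QN by (rule normalize_cols_proj[OF diag])
  have VW: "V = W * mat_adjoint P"
  proof -
    have "W * mat_adjoint P = V * (P * mat_adjoint P)" by (simp add: W_def mult_mat_assoc)
    then show ?thesis unfolding unitary_matD(4)[OF P] using V by (simp add: right_mult_one_mat)
  qed
  have "Q * (mat_adjoint Q * V) = (Q * (mat_adjoint Q * W)) * mat_adjoint P"
    by (subst VW) (simp add: mult_mat_assoc)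
  then show "Q * (mat_adjoint Q * V) = V" unfolding QW VW[symmetric] .
  \<comment> \<open>As \<open>Q\<close> arises from \<open>W\<close> by scaling columns, the
    identity that recovers \<open>W\<close> also recovers \<open>Q\<close>.\<close>
  have Q_scale: "Q = W * mat_diag m (\<lambda>j. 1 / csqrt (d $ j))"
    by (subst mat_diag_mult_right[of _ n]) (auto simp: Q W_def intro!: carrier_matI eq_matI)
  have "(Q * (mat_adjoint Q * W)) * mat_diag m (\<lambda>j. 1 / csqrt (d $ j)) = Q"
    unfolding QW Q_scale[symmetric] ..
  then have QQ: "Q * (mat_adjoint Q * Q) = Q"
    using Q_scale by (simp add: mult_mat_assoc mat_diag_def)
  show "mat_adjoint Q * (Q * mat_adjoint Q) = mat_adjoint Q"
    using arg_cong[OF QQ, of mat_adjoint] by (simp add: mat_adjoint_mult mult_mat_assoc)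
qed

text \<open>Multiplication by \<open>U\<^sup>*\<close> cancels the outer \<open>U\<close> of the
  subtracted term, leaving \<open>U\<^sup>* G\<close> minus its adjoint, and
  \<open>U\<^sup>* G\<close> factors through \<open>c\<close>.\<close>

lemma rotation_generator_low_rank:
  fixes U a b :: "complex mat"
  assumes U: "unitary_mat n U" and a: "a \<in> carrier_mat n k" and b: "b \<in> carrier_mat n k"
    and c: "c = mat_adjoint U * a"
  shows "- of_real \<eta> \<cdot>\<^sub>m (mat_adjoint U * tangent_proj U (a * mat_adjoint b)) =
    (- of_real \<eta> / 2) \<cdot>\<^sub>m (c * mat_adjoint b - b * mat_adjoint c)"
proof -
  have [simp]: "dim_row U = n" "dim_col U = n" "dim_row a = n" "dim_col a = k"
      "dim_row b = n" "dim_col b = k" "dim_row c = n" "dim_col c = k"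
    using a b unitary_matD[OF U] by (auto simp: c)
  define G where "G = a * mat_adjoint b"
  have [simp]: "dim_row G = n" "dim_col G = n" by (auto simp: G_def)
  have UG: "mat_adjoint U * G = c * mat_adjoint b" by (simp add: G_def c mult_mat_assoc)
  have "mat_adjoint U * (U * mat_adjoint G * U) = (mat_adjoint U * U) * (mat_adjoint G * U)"
    by (simp add: mult_mat_assoc)
  also have "\<dots> = mat_adjoint G * U"
    unfolding unitary_matD(3)[OF U] by (rule left_mult_one_mat[of _ n n]) auto
  also have "\<dots> = mat_adjoint (mat_adjoint U * G)" by (simp add: mat_adjoint_mult)
  also have "\<dots> = b * mat_adjoint c" unfolding UG by (simp add: mat_adjoint_mult)
  finally have UUGU: "mat_adjoint U * (U * mat_adjoint G * U) = b * mat_adjoint c" .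
  have "mat_adjoint U * tangent_proj U G =
      (1 / 2) \<cdot>\<^sub>m (mat_adjoint U * G - mat_adjoint U * (U * mat_adjoint G * U))"
    by (subst tangent_proj_complex[OF U])
      (auto simp: mult_smult_distrib[of _ n n _ n] mult_minus_distrib_mat[of _ n n _ n] carrier_matI
        simp del: assoc_mult_mat)
  also have "\<dots> = (1 / 2) \<cdot>\<^sub>m (c * mat_adjoint b - b * mat_adjoint c)"
    unfolding UG UUGU ..
  finally show ?thesis
    unfolding G_def[symmetric] by (simp, intro eq_matI) (auto simp: field_simps)
qed

text \<open>Each premise names the content of an array of the program, so the lemma can be
  instantiated by the successive results of its execution. The compressed matrix \<open>S\<close> is
  assembled from the small products with \<open>c\<close> and \<open>b\<close>; the exponent of size
  \<open>n\<close> is never formed.\<close>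

lemma rotation_update_low_rank:
  fixes U a b :: "complex mat"
  assumes U: "unitary_mat n U" and a: "a \<in> carrier_mat n k" and b: "b \<in> carrier_mat n k"
    and E: "is_eigensolver E"
    and c: "c = mat_adjoint U * a"
    and V: "V = mat n (k + k) (\<lambda>(i, j). if j < k then c $$ (i, j) else b $$ (i, j - k))"
    and EV: "E (mat_adjoint V * V) = (P, d)"
    and Q: "Q = mat n (k + k) (\<lambda>(i, j). (V * P) $$ (i, j) / csqrt (d $ j))"
    and N: "N = (mat_adjoint Q * c) * mat_adjoint (mat_adjoint Q * b)"
    and S: "S = mat (k + k) (k + k) (\<lambda>(i, j). (- of_real \<eta> / 2) * (N $$ (i, j) - cnj (N $$ (j, i))))"
    and ES: "E S = (R, l)"
    and F: "F = Q * R"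
  shows "rotation_update U (a * mat_adjoint b) \<eta> =
    U + (U * F) * mat (k + k) n (\<lambda>(i, j). (exp (l $ i) - 1) * cnj (F $$ (j, i)))"
proof -
  define m where "m = k + k"
  define h where "h = - complex_of_real \<eta> / 2"
  have [simp]: "dim_row U = n" "dim_col U = n" "dim_row a = n" "dim_col a = k"
      "dim_row b = n" "dim_col b = k" "dim_row c = n" "dim_col c = k"
      "dim_row V = n" "dim_col V = m" "dim_row Q = n" "dim_col Q = m" "dim_row N = m" "dim_col N = m"
      "dim_row S = m" "dim_col S = m"
    using a b unitary_matD[OF U] by (auto simp: c V Q N S m_def)
  have "V \<in> carrier_mat n m" by (auto intro: carrier_matI)
  note Q_V = normalize_gram_eigenvectors[OF this E EV, OF Q[folded m_def]]
  have QQ: "mat_adjoint Q * (Q * mat_adjoint Q) = mat_adjoint Q" by (fact Q_V(2))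
  \<comment> \<open>The matrices \<open>c\<close> and \<open>b\<close> are the column ranges of
    \<open>V\<close> at offsets 0 and \<open>k\<close>, and inherit from \<open>V\<close> that
    \<open>Q Q\<^sup>*\<close> fixes them.\<close>
  have fix_col: "Q * (mat_adjoint Q * C) = C"
    if C: "dim_row C = n" "dim_col C = k" and off: "\<And>i j. i < n \<Longrightarrow> j < k \<Longrightarrow> C $$ (i, j) = V $$ (i, j + o')"
      and o': "o' \<le> k" for C o'
  proof -
    have col: "col C j = col V (j + o')" if "j < k" for j
      using that C off o' by (intro eq_vecI) (auto simp: m_def)
    show ?thesis
    proof (rule eq_matI)
      fix i j assume "i < dim_row C" "j < dim_col C"
      then have ij: "i < n" "j < k" using C by auto
      have "(Q * (mat_adjoint Q * C)) $$ (i, j) = (Q * mat_adjoint Q * C) $$ (i, j)"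
        using C by (simp add: mult_mat_assoc)
      also have "\<dots> = (Q * mat_adjoint Q * V) $$ (i, j + o')"
        using ij C o' by (subst (1 2) index_mult_mat(1)) (auto simp: col m_def)
      also have "\<dots> = C $$ (i, j)"
        using off[OF ij] Q_V(1) by (simp add: mult_mat_assoc)
      finally show "(Q * (mat_adjoint Q * C)) $$ (i, j) = C $$ (i, j)" .
    qed (use C in auto)
  qed
  have Qc: "Q * (mat_adjoint Q * c) = c"
    by (rule fix_col[of _ 0]) (auto simp: V)
  have Qb: "Q * (mat_adjoint Q * b) = b"
    by (rule fix_col[of _ k]) (auto simp: V)
  have S_alt: "S = h \<cdot>\<^sub>m (N - mat_adjoint N)"
    by (rule eq_matI) (auto simp: S h_def m_def)
  have skew: "mat_adjoint S = - S"
    unfolding S_alt by (rule eq_matI) (auto simp: h_def field_simps)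
  have "S \<in> carrier_mat m m" by (auto intro: carrier_matI)
  note SD = eigensolver_skew_hermitian[OF E this skew ES]
  have R: "unitary_mat m R" and eig: "S * R = R * mat_diag m (($) l)" by (fact SD)+
  define L where "L = mat_diag m (($) l)"
  have [simp]: "dim_row L = m" "dim_col L = m" "dim_row R = m" "dim_col R = m" "dim_row F = n" "dim_col F = m"
    using unitary_matD[OF R] by (auto simp: L_def mat_diag_def F)
  have SR: "S * R = R * L" using eig by (simp add: L_def)
  have RSR: "mat_adjoint R * (S * R) = L"
  proof -
    have "mat_adjoint R * (S * R) = (mat_adjoint R * R) * L" unfolding SR by (simp add: mult_mat_assoc)
    then show ?thesis unfolding unitary_matD(3)[OF R] by (simp add: left_mult_one_mat[of L m m] carrier_matI)
  qed
  \<comment> \<open>\<open>Q\<^sup>* Q\<close> may differ from the identity, but \<open>S\<close>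
    consists of terms that begin with \<open>Q\<^sup>*\<close>, on which it acts trivially.\<close>
  have SQ: "mat_adjoint Q * (Q * S) = S"
  proof -
    have 1: "mat_adjoint Q * (Q * N) = N"
    proof -
      have "mat_adjoint Q * (Q * N) =
          mat_adjoint Q * (Q * mat_adjoint Q) * (c * mat_adjoint (mat_adjoint Q * b))"
        by (simp add: N mult_mat_assoc)
      then show ?thesis unfolding QQ by (simp add: N mult_mat_assoc)
    qed
    have 2: "mat_adjoint Q * (Q * mat_adjoint N) = mat_adjoint N"
    proof -
      have "mat_adjoint Q * (Q * mat_adjoint N) =
          mat_adjoint Q * (Q * mat_adjoint Q) * (b * mat_adjoint (mat_adjoint Q * c))"
        by (simp add: N mult_mat_assoc mat_adjoint_mult)
      then show ?thesis unfolding QQ by (simp add: N mult_mat_assoc mat_adjoint_mult)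
    qed
    have "mat_adjoint Q * (Q * S) = h \<cdot>\<^sub>m (mat_adjoint Q * (Q * N) - mat_adjoint Q * (Q * mat_adjoint N))"
      unfolding S_alt
      by (simp add: carrier_matI mult_smult_distrib[of Q n m _ m] mult_minus_distrib_mat[of Q n m _ m]
          mult_smult_distrib[of "mat_adjoint Q" m n _ m] mult_minus_distrib_mat[of "mat_adjoint Q" m n _ m])
    then show ?thesis unfolding 1 2 S_alt .
  qed
  \<comment> \<open>The premise of \<open>mat_exp_diagonal_factor\<close>: \<open>R L\<close> equals
    \<open>S R\<close>, so \<open>Q\<^sup>* Q\<close> is absorbed by \<open>S\<close>.\<close>
  have proj: "mat_adjoint F * (F * L) = L"
  proof -
    have "mat_adjoint F * (F * L) = mat_adjoint R * (mat_adjoint Q * (Q * (R * L)))"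
      by (simp add: F mat_adjoint_mult mult_mat_assoc)
    also have "\<dots> = mat_adjoint R * (mat_adjoint Q * (Q * S) * R)"
      unfolding SR[symmetric] by (simp add: mult_mat_assoc)
    finally show ?thesis unfolding SQ RSR .
  qed
  have FLF: "F * L * mat_adjoint F = h \<cdot>\<^sub>m (c * mat_adjoint b - b * mat_adjoint c)"
  proof -
    have "F * L * mat_adjoint F = Q * ((R * L) * (mat_adjoint R * mat_adjoint Q))"
      by (simp add: F mat_adjoint_mult mult_mat_assoc)
    also have "\<dots> = Q * (S * ((R * mat_adjoint R) * mat_adjoint Q))"
      unfolding SR[symmetric] by (simp add: mult_mat_assoc)
    also have "\<dots> = Q * (S * mat_adjoint Q)"
      unfolding unitary_matD(4)[OF R] by (simp add: left_mult_one_mat[of _ m n] carrier_matI)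
    also have "\<dots> = h \<cdot>\<^sub>m (Q * (N * mat_adjoint Q) - Q * (mat_adjoint N * mat_adjoint Q))"
      unfolding S_alt
      by (simp add: carrier_matI mult_smult_assoc_mat[of _ m m _ n] minus_mult_distrib_mat[of _ m m _ _ n]
          mult_smult_distrib[of Q n m _ n] mult_minus_distrib_mat[of Q n m _ n])
    also have "Q * (N * mat_adjoint Q) = c * mat_adjoint b"
    proof -
      have "Q * (N * mat_adjoint Q) = (Q * (mat_adjoint Q * c)) * mat_adjoint (Q * (mat_adjoint Q * b))"
        by (simp add: N mat_adjoint_mult mult_mat_assoc)
      then show ?thesis unfolding Qc Qb .
    qed
    also have "Q * (mat_adjoint N * mat_adjoint Q) = b * mat_adjoint c"
    proof -
      have "Q * (mat_adjoint N * mat_adjoint Q) = (Q * (mat_adjoint Q * b)) * mat_adjoint (Q * (mat_adjoint Q * c))"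
        by (simp add: N mat_adjoint_mult mult_mat_assoc)
      then show ?thesis unfolding Qc Qb .
    qed
    finally show ?thesis .
  qed
  have Fc: "F \<in> carrier_mat n m" by (auto intro: carrier_matI)
  define X where "X = mat m n (\<lambda>(i, j). (exp (l $ i) - 1) * cnj (F $$ (j, i)))"
  have [simp]: "dim_row X = m" "dim_col X = n" by (auto simp: X_def)
  have "rotation_update U (a * mat_adjoint b) \<eta> = U * (1\<^sub>m n + F * X)"
    unfolding rotation_update_def rotation_generator_low_rank[OF U a b c] FLF[unfolded h_def, symmetric]
    unfolding X_def L_def
    by (subst mat_exp_diagonal_factor[OF Fc proj[unfolded L_def]]) simp
  also have "\<dots> = U + (U * F) * X"
    by (simp add: mult_add_distrib_mat[of _ n n _ n] carrier_matI mult_mat_assoc right_mult_one_mat[of _ n n])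
  finally show ?thesis unfolding X_def m_def .
qed

lemma sum_outer_eq_mult:
  "sum_outer n k a b =
    mat n k (\<lambda>(i, l). a l $ i) * mat_adjoint (mat n k (\<lambda>(i, l). b l $ i))"
  unfolding sum_outer_def
  by (rule eq_matI) (auto simp: index_mult_mat_sum simp del: index_mult_mat(1))

section \<open>Transfer from real to complex matrices\<close>

lemma unitary_mat_map_of_real:
  assumes "unitary_mat n U"
  shows "unitary_mat n (map_mat complex_of_real U)"
proof (rule unitary_matI)
  have U: "U \<in> carrier_mat n n" using assms by (simp add: unitary_mat_def)
  show "mat_adjoint (map_mat complex_of_real U) * map_mat complex_of_real U = 1\<^sub>m n"
    unfolding mat_adjoint_map_of_real
    by (subst of_real_hom.mat_hom_mult[symmetric, of _ n n _ n])
      (use U unitary_matD(3)[OF assms] in \<open>auto simp: of_real_hom.mat_hom_one\<close>)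
qed (use unitary_matD[OF assms] in auto)

text \<open>Products, adjoints, the closed form of the projection and the exponential all commute
  with the embedding. Hence the complex computation on real data ends in the embedded real
  update.\<close>

lemma rotation_update_map_of_real:
  assumes U: "unitary_mat n U" and G: "G \<in> carrier_mat n n"
  shows "rotation_update (map_mat complex_of_real U) (map_mat complex_of_real G) \<eta> =
    map_mat complex_of_real (rotation_update U G \<eta>)"
proof -
  let ?h = "map_mat complex_of_real"
  have Uc: "U \<in> carrier_mat n n" using U by (simp add: unitary_mat_def)
  note hom = of_real_hom.mat_hom_mult[of _ n n _ n, symmetric, where 'a = complex]
  have proj: "tangent_proj (?h U) (?h G) = ?h (tangent_proj U G)"
    unfolding tangent_proj_real[OF U G]
    by (subst tangent_proj_complex[OF unitary_mat_map_of_real[OF U]])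
      (use Uc G in \<open>auto simp: mat_adjoint_map_of_real hom intro!: eq_matI simp del: index_mult_mat(1)\<close>)
  have T: "tangent_proj U G \<in> carrier_mat n n"
    unfolding tangent_proj_real[OF U G] using Uc G by auto
  define A where "A = - of_real \<eta> \<cdot>\<^sub>m (mat_adjoint U * tangent_proj U G)"
  have hA: "- of_real \<eta> \<cdot>\<^sub>m (mat_adjoint (?h U) * tangent_proj (?h U) (?h G)) = ?h A"
    unfolding proj A_def mat_adjoint_map_of_real using Uc T
    by (subst hom) (auto intro!: eq_matI simp del: index_mult_mat(1))
  have A: "A \<in> carrier_mat n n"
    unfolding A_def by (rule carrier_matI) (use Uc T in auto)
  then have "mat_exp A \<in> carrier_mat n n"
    by (auto simp: mat_exp_def)
  then show ?thesis
    unfolding rotation_update_def hA A_def[symmetric] mat_exp_map_of_real[OF A]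
    by (intro hom[OF Uc])
qed

section \<open>Program logic\<close>

text \<open>The initial store is an argument instead of being described by a precondition, so
  \<open>Q\<close> can relate the final store to it.\<close>

definition runs ::
    "nat \<Rightarrow> (complex mat \<Rightarrow> complex mat \<times> complex vec) \<Rightarrow> com \<Rightarrow> store \<Rightarrow> (store \<Rightarrow> bool) \<Rightarrow> nat \<Rightarrow> bool"
  where "runs K E c s Q T \<longleftrightarrow> (case exec K E c s of (s', t) \<Rightarrow> Q s' \<and> t \<le> T)"

lemma runs_weaken:
  assumes "runs K E c s Q T" "\<And>s'. Q s' \<Longrightarrow> Q' s'" "T \<le> T'"
  shows "runs K E c s Q' T'"
  using assms by (auto simp: runs_def)

lemma runsE:
  assumes "runs K E c s Q T"
  obtains s' t where "exec K E c s = (s', t)" "Q s'" "t \<le> T"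
  using assms by (auto simp: runs_def split: prod.splits)

lemma runs_Seq:
  assumes "runs K E c1 s Q1 T1" "\<And>s1. Q1 s1 \<Longrightarrow> runs K E c2 s1 Q2 T2"
  shows "runs K E (Seq c1 c2) s Q2 (T1 + T2)"
  using assms by (fastforce simp: runs_def split: prod.splits)

text \<open>The invariant speaks of the store before the counter is written, the body of the store
  after. \<open>Suc T\<close> includes the step charged for an iteration.\<close>

lemma runs_For:
  assumes N: "ival s e = N" and init: "I 0 s"
    and step: "\<And>i s'. i < N \<Longrightarrow> I i s' \<Longrightarrow> runs K E c (write_index x i s') (I (Suc i)) T"
  shows "runs K E (For x e c) s (I N) (N * Suc T)"
proof -
  have "case iterate (\<lambda>i s'. exec K E c (write_index x i s')) p s of (s', t) \<Rightarrow> I p s' \<and> t \<le> p * Suc T"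
    if "p \<le> N" for p
    using that
  proof (induction p)
    case 0
    then show ?case using init by simp
  next
    case (Suc p)
    obtain s1 t1 where 1: "iterate (\<lambda>i s'. exec K E c (write_index x i s')) p s = (s1, t1)"
      by fastforce
    obtain s2 t2 where 2: "exec K E c (write_index x p s1) = (s2, t2)" by fastforce
    from Suc 1 2 step[of p s1] show ?case by (auto simp: runs_def)
  qed
  then show ?thesis by (simp add: runs_def N)
qed

section \<open>Matrices stored in arrays, and frame conditions\<close>

definition block :: "store \<Rightarrow> vname \<Rightarrow> nat \<Rightarrow> nat \<Rightarrow> complex mat" where
  "block s x p q = mat p q (\<lambda>(i, j). snd s x i j)"

lemma dim_block [simp]: "dim_row (block s x p q) = p" "dim_col (block s x p q) = q"
  by (auto simp: block_def)

lemma block_carrier [simp]: "block s x p q \<in> carrier_mat p q"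
  by (auto intro: carrier_matI)

lemma index_block [simp]: "i < p \<Longrightarrow> j < q \<Longrightarrow> block s x p q $$ (i, j) = snd s x i j"
  by (auto simp: block_def)

abbreviation loop_vars :: "vname set" where
  "loop_vars \<equiv> {''i'', ''j'', ''l''}"

definition changes_only :: "vname set \<Rightarrow> store \<Rightarrow> store \<Rightarrow> bool" where
  "changes_only X s s' \<longleftrightarrow>
     (\<forall>x. x \<notin> loop_vars \<longrightarrow> fst s' x = fst s x) \<and> (\<forall>x. x \<notin> X \<longrightarrow> snd s' x = snd s x)"

lemma changes_only_block:
  "changes_only X s s' \<Longrightarrow> x \<notin> X \<Longrightarrow> block s' x p q = block s x p q"
  by (simp add: changes_only_def block_def)

lemma changes_only_fst: "changes_only X s s' \<Longrightarrow> x \<notin> loop_vars \<Longrightarrow> fst s' x = fst s x"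
  by (simp add: changes_only_def)

lemma changes_only_snd: "changes_only X s s' \<Longrightarrow> x \<notin> X \<Longrightarrow> snd s' x = snd s x"
  by (simp add: changes_only_def)

text \<open>An inner loop evaluates its bound anew in each round of the outer one; this property
  ensures that the value is the same every time.\<close>

definition loop_free :: "iexp \<Rightarrow> bool" where
  "loop_free e \<longleftrightarrow> (\<forall>s s'. (\<forall>x. x \<notin> loop_vars \<longrightarrow> fst s' x = fst s x) \<longrightarrow> ival s' e = ival s e)"

lemma loop_free_Idx [simp]: "x \<notin> loop_vars \<Longrightarrow> loop_free (Idx x)"
  by (auto simp: loop_free_def)

lemma loop_free_IPlus [simp]: "loop_free e \<Longrightarrow> loop_free f \<Longrightarrow> loop_free (IPlus e f)"
  unfolding loop_free_def by (metis ival.simps(3))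

lemma changes_only_ival:
  assumes ch: "changes_only X s s'" and e: "loop_free e"
  shows "ival s' e = ival s e"
proof -
  have "\<forall>x. x \<notin> loop_vars \<longrightarrow> fst s' x = fst s x"
    using ch unfolding changes_only_def by (rule conjunct1)
  then show ?thesis by (rule e[unfolded loop_free_def, THEN spec, THEN spec, THEN mp])
qed

section \<open>Matrix routines\<close>

text \<open>The array \<open>t\<close> is scratch space.\<close>

definition Fill :: "iexp \<Rightarrow> iexp \<Rightarrow> com \<Rightarrow> com" where
  "Fill e f body = For ''i'' e (For ''j'' f body)"

text \<open>Stricter than \<open>changes_only\<close>: the counters \<open>''i''\<close> and
  \<open>''j''\<close> must survive, since the surrounding loops still use them to address
  entries.\<close>

definition sets_entry :: "vname \<Rightarrow> nat \<Rightarrow> nat \<Rightarrow> complex \<Rightarrow> store \<Rightarrow> store \<Rightarrow> bool" where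
  "sets_entry z i j w s s' \<longleftrightarrow>
     (\<forall>x. x \<noteq> ''l'' \<longrightarrow> fst s' x = fst s x) \<and>
     (\<forall>x. x \<notin> {z, ''t''} \<longrightarrow> snd s' x = snd s x) \<and>
     snd s' z = (snd s z)(i := (snd s z i)(j := w))"

text \<open>The body may assume that its entry of \<open>z\<close> still has the initial value, so
  the same rule covers overwriting and accumulating in place.\<close>

lemma runs_Fill:
  assumes ef: "loop_free e" "loop_free f" "ival s e = p" "ival s f = r"
    and body: "\<And>i j s'. i < p \<Longrightarrow> j < r \<Longrightarrow> changes_only {z, ''t''} s s' \<Longrightarrow>
      fst s' ''i'' = i \<Longrightarrow> fst s' ''j'' = j \<Longrightarrow> snd s' z i j = snd s z i j \<Longrightarrow>
      runs K E body s' (sets_entry z i j (F i j) s') T"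
  shows "runs K E (Fill e f body) s
    (\<lambda>s'. changes_only {z, ''t''} s s' \<and> block s' z p r = mat p r (\<lambda>(i, j). F i j))
    (p * Suc (r * Suc T))"
proof -
  \<comment> \<open>Entries before position \<open>(i, j)\<close> in row order are final, all others
    untouched. Reaching \<open>j = r\<close> in row \<open>i\<close> is the same as starting row
    \<open>Suc i\<close>.\<close>
  define I where "I i j s' \<longleftrightarrow> changes_only {z, ''t''} s s' \<and>
    (\<forall>i' j'. snd s' z i' j' =
      (if j' < r \<and> i' < i \<or> i' = i \<and> j' < j then F i' j' else snd s z i' j'))" for i j s'
  have "runs K E (Fill e f body) s (I p 0) (p * Suc (r * Suc T))"
    unfolding Fill_def
  proof (rule runs_For)
    show "ival s e = p" "I 0 0 s" using ef by (auto simp: I_def changes_only_def)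
  next
    fix i s1 assume i: "i < p" and I1: "I i 0 s1"
    define J where "J j s' \<longleftrightarrow> I i j s' \<and> fst s' ''i'' = i" for j s'
    have "runs K E (For ''j'' f body) (write_index ''i'' i s1) (J r) (r * Suc T)"
    proof (rule runs_For)
      have ch: "changes_only {z, ''t''} s (write_index ''i'' i s1)"
        using I1 by (auto simp: I_def changes_only_def write_index_def)
      show "ival (write_index ''i'' i s1) f = r"
        using changes_only_ival[OF ch] ef by simp
      show "J 0 (write_index ''i'' i s1)"
        using I1 ch by (auto simp: J_def I_def write_index_def)
    next
      fix j s2 assume j: "j < r" and J2: "J j s2"
      let ?s = "write_index ''j'' j s2"
      have ch: "changes_only {z, ''t''} s ?s"
        using J2 by (auto simp: J_def I_def changes_only_def write_index_def)
      have "runs K E body ?s (sets_entry z i j (F i j) ?s) T"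
        using J2 by (intro body i j ch) (auto simp: J_def I_def write_index_def)
      then show "runs K E body ?s (J (Suc j)) T"
      proof (rule runs_weaken)
        fix s' assume s': "sets_entry z i j (F i j) ?s s'"
        have "changes_only {z, ''t''} s s'"
          using ch s' by (auto simp: sets_entry_def changes_only_def)
        moreover have "fst s' ''i'' = i"
          using s' J2 by (auto simp: sets_entry_def J_def write_index_def)
        ultimately show "J (Suc j) s'"
          using s' J2 j by (auto simp: sets_entry_def J_def I_def write_index_def less_Suc_eq)
      qed simp
    qed
    then show "runs K E (For ''j'' f body) (write_index ''i'' i s1) (I (Suc i) 0) (r * Suc T)"
      by (rule runs_weaken) (auto simp: J_def I_def less_Suc_eq)
  qed
  then show ?thesis
    by (rule runs_weaken) (auto simp: I_def intro!: eq_matI)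
qed

definition AddProduct :: "vname \<Rightarrow> vname \<Rightarrow> vname \<Rightarrow> iexp \<Rightarrow> com" where
  "AddProduct z x y q =
     For ''l'' q
       (Seq (Assign (Cell ''t'' (Num 0) (Num 0))
               (Mul (Cell x (Idx ''i'') (Idx ''l'')) (Cell y (Idx ''l'') (Idx ''j''))))
            (Assign (Cell z (Idx ''i'') (Idx ''j''))
               (Add (Cell z (Idx ''i'') (Idx ''j'')) (Cell ''t'' (Num 0) (Num 0)))))"

text \<open>Three steps per term: the iteration, the product into the scratch cell, and the sum.
  Instructions have only cells as operands, so a product cannot be added directly.\<close>

lemma runs_AddProduct:
  assumes q: "ival s e = q" and ij: "fst s ''i'' = i" "fst s ''j'' = j"
    and names: "x \<notin> {z, ''t''}" "y \<notin> {z, ''t''}" "z \<noteq> ''t''"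
  shows "runs K E (AddProduct z x y e) s
    (sets_entry z i j (snd s z i j + (\<Sum>l<q. snd s x i l * snd s y l j)) s) (q * 3)"
proof -
  define I where "I l = sets_entry z i j (snd s z i j + (\<Sum>l<l. snd s x i l * snd s y l j)) s" for l
  have "runs K E (AddProduct z x y e) s (I q) (q * Suc 2)"
    unfolding AddProduct_def
  proof (rule runs_For[where I = I])
    show "I 0 s" by (auto simp: I_def sets_entry_def)
  next
    fix l s' assume "I l s'"
    then have s': "\<And>v. v \<noteq> ''l'' \<Longrightarrow> fst s' v = fst s v" "\<And>v. v \<notin> {z, ''t''} \<Longrightarrow> snd s' v = snd s v"
      "snd s' z = (snd s z)(i := (snd s z i)(j := snd s z i j + (\<Sum>l<l. snd s x i l * snd s y l j)))"
      unfolding I_def sets_entry_def by blast+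
    show "runs K E (Seq (Assign (Cell ''t'' (Num 0) (Num 0))
           (Mul (Cell x (Idx ''i'') (Idx ''l'')) (Cell y (Idx ''l'') (Idx ''j''))))
          (Assign (Cell z (Idx ''i'') (Idx ''j''))
           (Add (Cell z (Idx ''i'') (Idx ''j'')) (Cell ''t'' (Num 0) (Num 0)))))
        (write_index ''l'' l s') (I (Suc l)) 2"
      using names by (simp add: runs_def I_def sets_entry_def write_index_def s' ij add.assoc)
  qed (rule q)
  then show ?thesis by (simp add: I_def)
qed

text \<open>Without clearing \<open>z\<close> first, the product is accumulated onto its old
  content; this performs the final correction of \<open>U\<close> in place.\<close>

definition MatAdd :: "vname \<Rightarrow> vname \<Rightarrow> vname \<Rightarrow> iexp \<Rightarrow> iexp \<Rightarrow> iexp \<Rightarrow> com" where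
  "MatAdd z x y e g f = Fill e f (AddProduct z x y g)"

definition MatMul :: "vname \<Rightarrow> vname \<Rightarrow> vname \<Rightarrow> iexp \<Rightarrow> iexp \<Rightarrow> iexp \<Rightarrow> com" where
  "MatMul z x y e g f =
     Fill e f (Seq (Assign (Cell z (Idx ''i'') (Idx ''j'')) (IntLit 0)) (AddProduct z x y g))"

definition MatAdj :: "vname \<Rightarrow> vname \<Rightarrow> iexp \<Rightarrow> iexp \<Rightarrow> com" where
  "MatAdj z x e f = Fill e f (Assign (Cell z (Idx ''i'') (Idx ''j'')) (Conj (Cell x (Idx ''j'') (Idx ''i''))))"

lemma runs_MatAdd:
  assumes ef: "loop_free e" "loop_free g" "loop_free f" "ival s e = p" "ival s g = q" "ival s f = r"
    and names: "x \<notin> {z, ''t''}" "y \<notin> {z, ''t''}" "z \<noteq> ''t''"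
  shows "runs K E (MatAdd z x y e g f) s
    (\<lambda>s'. changes_only {z, ''t''} s s' \<and> block s' z p r = block s z p r + block s x p q * block s y q r)
    (p * Suc (r * Suc (q * 3)))"
  unfolding MatAdd_def
proof (rule runs_weaken[OF runs_Fill[where F = "\<lambda>i j. snd s z i j + (\<Sum>l<q. snd s x i l * snd s y l j)"]])
  fix i j s'
  assume ch: "changes_only {z, ''t''} s s'" and ij: "fst s' ''i'' = i" "fst s' ''j'' = j"
    and z: "snd s' z i j = snd s z i j"
  show "runs K E (AddProduct z x y g) s'
      (sets_entry z i j (snd s z i j + (\<Sum>l<q. snd s x i l * snd s y l j)) s') (q * 3)"
    using runs_AddProduct[of s' g q i j x z y K E] changes_only_ival[OF ch ef(2)] ef ij names z
      changes_only_snd[OF ch names(1)] changes_only_snd[OF ch names(2)]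
    by simp
qed (use ef in \<open>auto simp: index_mult_mat_sum intro!: eq_matI simp del: index_mult_mat(1)\<close>)

lemma runs_MatMul:
  assumes ef: "loop_free e" "loop_free g" "loop_free f" "ival s e = p" "ival s g = q" "ival s f = r"
    and names: "x \<notin> {z, ''t''}" "y \<notin> {z, ''t''}" "z \<noteq> ''t''"
  shows "runs K E (MatMul z x y e g f) s
    (\<lambda>s'. changes_only {z, ''t''} s s' \<and> block s' z p r = block s x p q * block s y q r)
    (p * Suc (r * Suc (1 + q * 3)))"
  unfolding MatMul_def
proof (rule runs_weaken[OF runs_Fill[where F = "\<lambda>i j. \<Sum>l<q. snd s x i l * snd s y l j"]])
  fix i j s'
  assume ch: "changes_only {z, ''t''} s s'" and ij: "fst s' ''i'' = i" "fst s' ''j'' = j"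
  let ?c = "Assign (Cell z (Idx ''i'') (Idx ''j'')) (IntLit 0)"
  show "runs K E (Seq ?c (AddProduct z x y g)) s'
      (sets_entry z i j (\<Sum>l<q. snd s x i l * snd s y l j) s') (1 + q * 3)"
  proof (rule runs_Seq)
    show "runs K E ?c s' (sets_entry z i j 0 s') 1"
      using ij names by (auto simp: runs_def sets_entry_def)
  next
    fix s1 assume s1: "sets_entry z i j 0 s' s1"
    then have ch1: "changes_only {z, ''t''} s s1"
      using ch by (auto simp: sets_entry_def changes_only_def)
    have "runs K E (AddProduct z x y g) s1
        (sets_entry z i j (snd s1 z i j + (\<Sum>l<q. snd s1 x i l * snd s1 y l j)) s1) (q * 3)"
      by (rule runs_AddProduct) (use changes_only_ival[OF ch1 ef(2)] ef s1 ij names in \<open>auto simp: sets_entry_def\<close>)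
    then show "runs K E (AddProduct z x y g) s1
        (sets_entry z i j (\<Sum>l<q. snd s x i l * snd s y l j) s') (q * 3)"
    proof (rule runs_weaken)
      fix s2
      assume "sets_entry z i j (snd s1 z i j + (\<Sum>l<q. snd s1 x i l * snd s1 y l j)) s1 s2"
      then show "sets_entry z i j (\<Sum>l<q. snd s x i l * snd s y l j) s' s2"
        using s1 changes_only_snd[OF ch1 names(1)] changes_only_snd[OF ch1 names(2)]
        by (auto simp: sets_entry_def)
    qed simp
  qed
qed (use ef in \<open>auto simp: index_mult_mat_sum intro!: eq_matI simp del: index_mult_mat(1)\<close>)

lemma runs_MatAdj:
  assumes ef: "loop_free e" "loop_free f" "ival s e = p" "ival s f = r"
    and names: "x \<notin> {z, ''t''}" "z \<noteq> ''t''"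
  shows "runs K E (MatAdj z x e f) s
    (\<lambda>s'. changes_only {z, ''t''} s s' \<and> block s' z p r = mat_adjoint (block s x r p))
    (p * Suc (r * 2))"
  unfolding MatAdj_def
proof (rule runs_weaken[OF runs_Fill[where F = "\<lambda>i j. cnj (snd s x j i)" and T = 1]])
  fix i j s'
  assume ch: "changes_only {z, ''t''} s s'" and ij: "fst s' ''i'' = i" "fst s' ''j'' = j"
  show "runs K E (Assign (Cell z (Idx ''i'') (Idx ''j'')) (Conj (Cell x (Idx ''j'') (Idx ''i'')))) s'
      (sets_entry z i j (cnj (snd s x j i)) s') 1"
    using ij names changes_only_snd[OF ch names(1)] by (auto simp: runs_def sets_entry_def)
qed (use ef in \<open>auto intro!: eq_matI\<close>)

lemma runs_Eigen:
  assumes m: "ival s e = m" and yz: "y \<noteq> z"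
    and EA: "E (block s x m m) = (P, d)" and P: "P \<in> carrier_mat m m"
  shows "runs K E (Eigen e x y z) s
    (\<lambda>s'. changes_only {y, z} s s' \<and> block s' y m m = P \<and> (\<forall>i<m. snd s' z i 0 = d $ i)) (K * m ^ 3)"
  using EA P yz
  by (auto simp: runs_def m Let_def block_def write_block_def changes_only_def intro!: eq_matI)

section \<open>Entrywise routines specific to the update\<close>

definition Concat :: "vname \<Rightarrow> vname \<Rightarrow> vname \<Rightarrow> iexp \<Rightarrow> iexp \<Rightarrow> iexp \<Rightarrow> com" where
  "Concat z x y e g f =
     Fill e f (Cond (IdxLess (Idx ''j'') g)
       (Assign (Cell z (Idx ''i'') (Idx ''j'')) (Copy (Cell x (Idx ''i'') (Idx ''j''))))
       (Assign (Cell z (Idx ''i'') (Idx ''j'')) (Copy (Cell y (Idx ''i'') (IMinus (Idx ''j'') g)))))"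

definition ScaleCols :: "vname \<Rightarrow> vname \<Rightarrow> vname \<Rightarrow> iexp \<Rightarrow> iexp \<Rightarrow> com" where
  "ScaleCols z x y e f =
     Fill e f (Seq (Assign (Cell ''t'' (Num 0) (Num 0)) (Sqrt (Cell y (Idx ''j'') (Num 0))))
       (Assign (Cell z (Idx ''i'') (Idx ''j''))
         (Div (Cell x (Idx ''i'') (Idx ''j'')) (Cell ''t'' (Num 0) (Num 0)))))"

text \<open>Literals are integers or the imaginary unit, so the factor \<open>- \<eta> / 2\<close>
  is realized by multiplying with \<open>y\<close> and dividing by the literal -2.\<close>

definition SkewPart :: "vname \<Rightarrow> vname \<Rightarrow> vname \<Rightarrow> iexp \<Rightarrow> com" where
  "SkewPart z x y e =
     Fill e e
      (Seq (Assign (Cell ''t'' (Num 0) (Num 0)) (Conj (Cell x (Idx ''j'') (Idx ''i''))))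
      (Seq (Assign (Cell ''t'' (Num 0) (Num 0))
              (Sub (Cell x (Idx ''i'') (Idx ''j'')) (Cell ''t'' (Num 0) (Num 0))))
      (Seq (Assign (Cell z (Idx ''i'') (Idx ''j'')) (Mul (Cell y (Num 0) (Num 0)) (Cell ''t'' (Num 0) (Num 0))))
      (Seq (Assign (Cell ''t'' (Num 0) (Num 0)) (IntLit (- 2)))
           (Assign (Cell z (Idx ''i'') (Idx ''j''))
              (Div (Cell z (Idx ''i'') (Idx ''j'')) (Cell ''t'' (Num 0) (Num 0))))))))"

text \<open>The target entry doubles as a second scratch cell, holding first the literal 1 and then
  the conjugate. Recomputing the exponential for every column costs only a constant factor.\<close>

definition ExpAdj :: "vname \<Rightarrow> vname \<Rightarrow> vname \<Rightarrow> iexp \<Rightarrow> iexp \<Rightarrow> com" where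
  "ExpAdj z x y e f =
     Fill e f
      (Seq (Assign (Cell ''t'' (Num 0) (Num 0)) (Exp (Cell y (Idx ''i'') (Num 0))))
      (Seq (Assign (Cell z (Idx ''i'') (Idx ''j'')) (IntLit 1))
      (Seq (Assign (Cell ''t'' (Num 0) (Num 0))
              (Sub (Cell ''t'' (Num 0) (Num 0)) (Cell z (Idx ''i'') (Idx ''j''))))
      (Seq (Assign (Cell z (Idx ''i'') (Idx ''j'')) (Conj (Cell x (Idx ''j'') (Idx ''i''))))
           (Assign (Cell z (Idx ''i'') (Idx ''j''))
              (Mul (Cell ''t'' (Num 0) (Num 0)) (Cell z (Idx ''i'') (Idx ''j''))))))))"

lemma runs_Concat:
  assumes ef: "loop_free e" "loop_free g" "loop_free f" "ival s e = p" "ival s g = q" "ival s f = q + r"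
    and names: "x \<notin> {z, ''t''}" "y \<notin> {z, ''t''}" "z \<noteq> ''t''"
  shows "runs K E (Concat z x y e g f) s
    (\<lambda>s'. changes_only {z, ''t''} s s' \<and> block s' z p (q + r) =
      mat p (q + r) (\<lambda>(i, j). if j < q then block s x p q $$ (i, j) else block s y p r $$ (i, j - q)))
    (p * Suc ((q + r) * 3))"
  unfolding Concat_def
proof (rule runs_weaken[OF runs_Fill[where T = 2 and
        F = "\<lambda>i j. if j < q then snd s x i j else snd s y i (j - q)"]])
  fix i j s'
  assume ch: "changes_only {z, ''t''} s s'" and ij: "fst s' ''i'' = i" "fst s' ''j'' = j"
  show "runs K E (Cond (IdxLess (Idx ''j'') g)
       (Assign (Cell z (Idx ''i'') (Idx ''j'')) (Copy (Cell x (Idx ''i'') (Idx ''j''))))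
       (Assign (Cell z (Idx ''i'') (Idx ''j'')) (Copy (Cell y (Idx ''i'') (IMinus (Idx ''j'') g))))) s'
      (sets_entry z i j (if j < q then snd s x i j else snd s y i (j - q)) s') 2"
    using ij names changes_only_ival[OF ch ef(2)] ef(5)
      changes_only_snd[OF ch names(1)] changes_only_snd[OF ch names(2)]
    by (simp add: runs_def sets_entry_def)
qed (use ef in \<open>auto intro!: eq_matI\<close>)

lemma runs_ScaleCols:
  assumes ef: "loop_free e" "loop_free f" "ival s e = p" "ival s f = r"
    and names: "x \<notin> {z, ''t''}" "y \<notin> {z, ''t''}" "z \<noteq> ''t''"
  shows "runs K E (ScaleCols z x y e f) s
    (\<lambda>s'. changes_only {z, ''t''} s s' \<and> block s' z p r =
      mat p r (\<lambda>(i, j). block s x p r $$ (i, j) / csqrt (snd s y j 0)))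
    (p * Suc (r * 3))"
  unfolding ScaleCols_def
proof (rule runs_weaken[OF runs_Fill[where T = 2 and F = "\<lambda>i j. snd s x i j / csqrt (snd s y j 0)"]])
  fix i j s'
  assume ch: "changes_only {z, ''t''} s s'" and ij: "fst s' ''i'' = i" "fst s' ''j'' = j"
  show "runs K E (Seq (Assign (Cell ''t'' (Num 0) (Num 0)) (Sqrt (Cell y (Idx ''j'') (Num 0))))
       (Assign (Cell z (Idx ''i'') (Idx ''j''))
         (Div (Cell x (Idx ''i'') (Idx ''j'')) (Cell ''t'' (Num 0) (Num 0))))) s'
      (sets_entry z i j (snd s x i j / csqrt (snd s y j 0)) s') 2"
    using ij names changes_only_snd[OF ch names(1)] changes_only_snd[OF ch names(2)]
    by (simp add: runs_def sets_entry_def)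
qed (use ef in \<open>auto intro!: eq_matI\<close>)

lemma runs_SkewPart:
  assumes e: "loop_free e" "ival s e = p"
    and names: "x \<notin> {z, ''t''}" "y \<notin> {z, ''t''}" "z \<noteq> ''t''"
  shows "runs K E (SkewPart z x y e) s
    (\<lambda>s'. changes_only {z, ''t''} s s' \<and> block s' z p p =
      mat p p (\<lambda>(i, j). (- snd s y 0 0 / 2) * (block s x p p $$ (i, j) - cnj (block s x p p $$ (j, i)))))
    (p * Suc (p * 6))"
  unfolding SkewPart_def
proof (rule runs_weaken[OF runs_Fill[where T = 5 and
        F = "\<lambda>i j. (- snd s y 0 0 / 2) * (snd s x i j - cnj (snd s x j i))"]])
  fix i j s'
  assume ch: "changes_only {z, ''t''} s s'" and ij: "fst s' ''i'' = i" "fst s' ''j'' = j"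
  show "runs K E
      (Seq (Assign (Cell ''t'' (Num 0) (Num 0)) (Conj (Cell x (Idx ''j'') (Idx ''i''))))
      (Seq (Assign (Cell ''t'' (Num 0) (Num 0))
              (Sub (Cell x (Idx ''i'') (Idx ''j'')) (Cell ''t'' (Num 0) (Num 0))))
      (Seq (Assign (Cell z (Idx ''i'') (Idx ''j'')) (Mul (Cell y (Num 0) (Num 0)) (Cell ''t'' (Num 0) (Num 0))))
      (Seq (Assign (Cell ''t'' (Num 0) (Num 0)) (IntLit (- 2)))
           (Assign (Cell z (Idx ''i'') (Idx ''j''))
              (Div (Cell z (Idx ''i'') (Idx ''j'')) (Cell ''t'' (Num 0) (Num 0)))))))) s'
      (sets_entry z i j ((- snd s y 0 0 / 2) * (snd s x i j - cnj (snd s x j i))) s') 5"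
    using ij names changes_only_snd[OF ch names(1)] changes_only_snd[OF ch names(2)]
    by (simp add: runs_def sets_entry_def)
qed (use e in \<open>auto intro!: eq_matI\<close>)

lemma runs_ExpAdj:
  assumes ef: "loop_free e" "loop_free f" "ival s e = p" "ival s f = r"
    and names: "x \<notin> {z, ''t''}" "y \<notin> {z, ''t''}" "z \<noteq> ''t''"
  shows "runs K E (ExpAdj z x y e f) s
    (\<lambda>s'. changes_only {z, ''t''} s s' \<and> block s' z p r =
      mat p r (\<lambda>(i, j). (exp (snd s y i 0) - 1) * cnj (block s x r p $$ (j, i))))
    (p * Suc (r * 6))"
  unfolding ExpAdj_def
proof (rule runs_weaken[OF runs_Fill[where T = 5 and
        F = "\<lambda>i j. (exp (snd s y i 0) - 1) * cnj (snd s x j i)"]])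
  fix i j s'
  assume ch: "changes_only {z, ''t''} s s'" and ij: "fst s' ''i'' = i" "fst s' ''j'' = j"
  show "runs K E
      (Seq (Assign (Cell ''t'' (Num 0) (Num 0)) (Exp (Cell y (Idx ''i'') (Num 0))))
      (Seq (Assign (Cell z (Idx ''i'') (Idx ''j'')) (IntLit 1))
      (Seq (Assign (Cell ''t'' (Num 0) (Num 0))
              (Sub (Cell ''t'' (Num 0) (Num 0)) (Cell z (Idx ''i'') (Idx ''j''))))
      (Seq (Assign (Cell z (Idx ''i'') (Idx ''j'')) (Conj (Cell x (Idx ''j'') (Idx ''i''))))
           (Assign (Cell z (Idx ''i'') (Idx ''j''))
              (Mul (Cell ''t'' (Num 0) (Num 0)) (Cell z (Idx ''i'') (Idx ''j'')))))))) s'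
      (sets_entry z i j ((exp (snd s y i 0) - 1) * cnj (snd s x j i)) s') 5"
    using ij names changes_only_snd[OF ch names(1)] changes_only_snd[OF ch names(2)]
    by (simp add: runs_def sets_entry_def)
qed (use ef in \<open>auto intro!: eq_matI\<close>)

section \<open>The program\<close>

abbreviation (input) "idx_n \<equiv> Idx ''n''"
abbreviation (input) "idx_k \<equiv> Idx ''k''"
abbreviation (input) "idx_2k \<equiv> IPlus idx_k idx_k"

text \<open>Products are grouped so that none has all three dimensions equal to \<open>n\<close>.
  Only the adjoint of \<open>U\<close> and loop overheads lack a factor \<open>k\<close>, and these
  are absorbed once \<open>k\<close> is positive.\<close>

definition update_steps :: "com list" where
  "update_steps =
    [MatAdj ''UA'' ''U'' idx_n idx_n,
     MatMul ''c'' ''UA'' ''a'' idx_n idx_n idx_k,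
     Concat ''V'' ''c'' ''b'' idx_n idx_k idx_2k,
     MatAdj ''VA'' ''V'' idx_2k idx_n,
     MatMul ''G'' ''VA'' ''V'' idx_2k idx_n idx_2k,
     Eigen idx_2k ''G'' ''P'' ''d'',
     MatMul ''W'' ''V'' ''P'' idx_n idx_2k idx_2k,
     ScaleCols ''Q'' ''W'' ''d'' idx_n idx_2k,
     MatAdj ''QA'' ''Q'' idx_2k idx_n,
     MatMul ''M'' ''QA'' ''c'' idx_2k idx_n idx_k,
     MatMul ''B'' ''QA'' ''b'' idx_2k idx_n idx_k,
     MatAdj ''BA'' ''B'' idx_k idx_2k,
     MatMul ''N'' ''M'' ''BA'' idx_2k idx_k idx_2k,
     SkewPart ''S'' ''N'' ''eta'' idx_2k,
     Eigen idx_2k ''S'' ''R'' ''D'',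
     MatMul ''F'' ''Q'' ''R'' idx_n idx_2k idx_2k,
     MatMul ''H'' ''U'' ''F'' idx_n idx_n idx_2k,
     ExpAdj ''X'' ''F'' ''D'' idx_2k idx_n,
     MatAdd ''U'' ''H'' ''X'' idx_n idx_2k idx_n]"

text \<open>For \<open>k = 0\<close> the budget is zero steps, and only an empty loop is free of charge.\<close>

definition update_prog :: com where
  "update_prog = For ''w'' (IMinus idx_k (IMinus idx_k (Num 1))) (foldr Seq update_steps Skip)"



lemma runs_update_steps:
  fixes U :: "complex mat"
  assumes E: "is_eigensolver E" and U: "unitary_mat n U"
    and a: "a \<in> carrier_mat n k" and b: "b \<in> carrier_mat n k"
    and nk: "fst s ''n'' = n" "fst s ''k'' = k"
    and sU: "block s ''U'' n n = U" and sa: "block s ''a'' n k = a" and sb: "block s ''b'' n k = b"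
    and seta: "snd s ''eta'' 0 0 = complex_of_real \<eta>"
    and k: "k > 0"
  shows "runs K E (foldr Seq update_steps Skip) s
    (\<lambda>s'. block s' ''U'' n n = rotation_update U (a * mat_adjoint b) \<eta>)
    ((400 + 16 * K) * (k * (n\<^sup>2 + n * k + k\<^sup>2)))"
proof -
  \<comment> \<open>Symbolic execution: after each command \<open>known\<close> is extended by the
    new array and by the frame facts, so that \<open>simp\<close> traces any array back to the
    command that wrote it.\<close>
  note known = nk sU sa sb seta
  have "runs K E (MatAdj ''UA'' ''U'' idx_n idx_n) s
      (\<lambda>s'. changes_only {''UA'', ''t''} s s' \<and> block s' ''UA'' n n = mat_adjoint U)
      (n * Suc (n * 2))"
    using runs_MatAdj[of idx_n idx_n s n n "''U''" "''UA''" K E]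
    by (simp add: known)
  then obtain s1 t1 where e1: "exec K E (MatAdj ''UA'' ''U'' idx_n idx_n) s = (s1, t1)"
    and c1: "changes_only {''UA'', ''t''} s s1" and r1: "block s1 ''UA'' n n = mat_adjoint U"
    and t1: "t1 \<le> n * Suc (n * 2)"
    by (elim runsE conjE)
  note known = known r1 changes_only_fst[OF c1] changes_only_block[OF c1] changes_only_snd[OF c1]
  define c where "c = mat_adjoint U * a"
  have "runs K E (MatMul ''c'' ''UA'' ''a'' idx_n idx_n idx_k) s1
      (\<lambda>s'. changes_only {''c'', ''t''} s1 s' \<and> block s' ''c'' n k = c)
      (n * Suc (k * Suc (1 + n * 3)))"
    using runs_MatMul[of idx_n idx_n idx_k s1 n n k "''UA''" "''c''" "''a''" K E]
    by (simp add: known c_def)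
  then obtain s2 t2 where e2: "exec K E (MatMul ''c'' ''UA'' ''a'' idx_n idx_n idx_k) s1 = (s2, t2)"
    and c2: "changes_only {''c'', ''t''} s1 s2" and r2: "block s2 ''c'' n k = c"
    and t2: "t2 \<le> n * Suc (k * Suc (1 + n * 3))"
    by (elim runsE conjE)
  note known = known r2 changes_only_fst[OF c2] changes_only_block[OF c2] changes_only_snd[OF c2]
  define V where "V = mat n (k + k) (\<lambda>(i, j). if j < k then c $$ (i, j) else b $$ (i, j - k))"
  have "runs K E (Concat ''V'' ''c'' ''b'' idx_n idx_k idx_2k) s2
      (\<lambda>s'. changes_only {''V'', ''t''} s2 s' \<and> block s' ''V'' n (k + k) = V)
      (n * Suc ((k + k) * 3))"
    using runs_Concat[of idx_n idx_k idx_2k s2 n k k "''c''" "''V''" "''b''" K E]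
    by (simp add: known V_def cong: if_cong)
  then obtain s3 t3 where e3: "exec K E (Concat ''V'' ''c'' ''b'' idx_n idx_k idx_2k) s2 = (s3, t3)"
    and c3: "changes_only {''V'', ''t''} s2 s3" and r3: "block s3 ''V'' n (k + k) = V"
    and t3: "t3 \<le> n * Suc ((k + k) * 3)"
    by (elim runsE conjE)
  note known = known r3 changes_only_fst[OF c3] changes_only_block[OF c3] changes_only_snd[OF c3]
  have "runs K E (MatAdj ''VA'' ''V'' idx_2k idx_n) s3
      (\<lambda>s'. changes_only {''VA'', ''t''} s3 s' \<and> block s' ''VA'' (k + k) n = mat_adjoint V)
      ((k + k) * Suc (n * 2))"
    using runs_MatAdj[of idx_2k idx_n s3 "k + k" n "''V''" "''VA''" K E]
    by (simp add: known)
  then obtain s4 t4 where e4: "exec K E (MatAdj ''VA'' ''V'' idx_2k idx_n) s3 = (s4, t4)"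
    and c4: "changes_only {''VA'', ''t''} s3 s4" and r4: "block s4 ''VA'' (k + k) n = mat_adjoint V"
    and t4: "t4 \<le> (k + k) * Suc (n * 2)"
    by (elim runsE conjE)
  note known = known r4 changes_only_fst[OF c4] changes_only_block[OF c4] changes_only_snd[OF c4]

  have [simp]: "dim_row V = n" "dim_col V = k + k" by (simp_all add: V_def)
  have "runs K E (MatMul ''G'' ''VA'' ''V'' idx_2k idx_n idx_2k) s4
      (\<lambda>s'. changes_only {''G'', ''t''} s4 s' \<and> block s' ''G'' (k + k) (k + k) = mat_adjoint V * V)
      ((k + k) * Suc ((k + k) * Suc (1 + n * 3)))"
    using runs_MatMul[of idx_2k idx_n idx_2k s4 "k + k" n "k + k" "''VA''" "''G''" "''V''" K E]
    by (simp add: known)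
  then obtain s5 t5 where e5: "exec K E (MatMul ''G'' ''VA'' ''V'' idx_2k idx_n idx_2k) s4 = (s5, t5)"
    and c5: "changes_only {''G'', ''t''} s4 s5" and r5: "block s5 ''G'' (k + k) (k + k) = mat_adjoint V * V"
    and t5: "t5 \<le> (k + k) * Suc ((k + k) * Suc (1 + n * 3))"
    by (elim runsE conjE)
  note known = known r5 changes_only_fst[OF c5] changes_only_block[OF c5] changes_only_snd[OF c5]
  obtain P d where EV: "E (mat_adjoint V * V) = (P, d)" by fastforce
  have "mat_adjoint V * V \<in> carrier_mat (k + k) (k + k)" by (rule carrier_matI) auto
  \<comment> \<open>Nothing is known about an answer of \<open>E\<close>, not even its size, unless
    the matrix is diagonalizable; the Hermitian case guarantees it here.\<close>
  from eigensolver_hermitian(1)[OF E this _ EV] have P: "P \<in> carrier_mat (k + k) (k + k)"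
    by (simp add: mat_adjoint_mult unitary_mat_def)
  have "runs K E (Eigen idx_2k ''G'' ''P'' ''d'') s5
      (\<lambda>s'. changes_only {''P'', ''d''} s5 s' \<and> block s' ''P'' (k + k) (k + k) = P \<and> (\<forall>i<k + k. snd s' ''d'' i 0 = d $ i))
      (K * (k + k) ^ 3)"
    by (rule runs_Eigen) (simp_all add: known EV P)
  then obtain s6 t6 where e6: "exec K E (Eigen idx_2k ''G'' ''P'' ''d'') s5 = (s6, t6)"
    and c6: "changes_only {''P'', ''d''} s5 s6" and r6: "block s6 ''P'' (k + k) (k + k) = P"
    and z6: "\<forall>i<k + k. snd s6 ''d'' i 0 = d $ i" and t6: "t6 \<le> K * (k + k) ^ 3"
    by (elim runsE conjE)
  note known = known r6 changes_only_fst[OF c6] changes_only_block[OF c6] changes_only_snd[OF c6]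
  define Q where "Q = mat n (k + k) (\<lambda>(i, j). (V * P) $$ (i, j) / csqrt (d $ j))"
  \<comment> \<open>The array holds the eigenvalues only in its first \<open>k + k\<close> cells, so
    the replacement is justified entry by entry within the matrix bounds.\<close>
  have Q_eq: "mat n (k + k) (\<lambda>(i, j). (V * P) $$ (i, j) / csqrt (snd s6 ''d'' j 0)) = Q"
    unfolding Q_def by (rule cong_mat) (use z6 in auto)
  have "runs K E (MatMul ''W'' ''V'' ''P'' idx_n idx_2k idx_2k) s6
      (\<lambda>s'. changes_only {''W'', ''t''} s6 s' \<and> block s' ''W'' n (k + k) = V * P)
      (n * Suc ((k + k) * Suc (1 + (k + k) * 3)))"
    using runs_MatMul[of idx_n idx_2k idx_2k s6 n "k + k" "k + k" "''V''" "''W''" "''P''" K E]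
    by (simp add: known)
  then obtain s7 t7 where e7: "exec K E (MatMul ''W'' ''V'' ''P'' idx_n idx_2k idx_2k) s6 = (s7, t7)"
    and c7: "changes_only {''W'', ''t''} s6 s7" and r7: "block s7 ''W'' n (k + k) = V * P"
    and t7: "t7 \<le> n * Suc ((k + k) * Suc (1 + (k + k) * 3))"
    by (elim runsE conjE)
  note known = known r7 changes_only_fst[OF c7] changes_only_block[OF c7] changes_only_snd[OF c7]
  have "runs K E (ScaleCols ''Q'' ''W'' ''d'' idx_n idx_2k) s7
      (\<lambda>s'. changes_only {''Q'', ''t''} s7 s' \<and> block s' ''Q'' n (k + k) = Q)
      (n * Suc ((k + k) * 3))"
    using runs_ScaleCols[of idx_n idx_2k s7 n "k + k" "''W''" "''Q''" "''d''" K E]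
    by (simp add: known Q_eq)
  then obtain s8 t8 where e8: "exec K E (ScaleCols ''Q'' ''W'' ''d'' idx_n idx_2k) s7 = (s8, t8)"
    and c8: "changes_only {''Q'', ''t''} s7 s8" and r8: "block s8 ''Q'' n (k + k) = Q"
    and t8: "t8 \<le> n * Suc ((k + k) * 3)"
    by (elim runsE conjE)
  note known = known r8 changes_only_fst[OF c8] changes_only_block[OF c8] changes_only_snd[OF c8]
  have "runs K E (MatAdj ''QA'' ''Q'' idx_2k idx_n) s8
      (\<lambda>s'. changes_only {''QA'', ''t''} s8 s' \<and> block s' ''QA'' (k + k) n = mat_adjoint Q)
      ((k + k) * Suc (n * 2))"
    using runs_MatAdj[of idx_2k idx_n s8 "k + k" n "''Q''" "''QA''" K E]
    by (simp add: known)
  then obtain s9 t9 where e9: "exec K E (MatAdj ''QA'' ''Q'' idx_2k idx_n) s8 = (s9, t9)"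
    and c9: "changes_only {''QA'', ''t''} s8 s9" and r9: "block s9 ''QA'' (k + k) n = mat_adjoint Q"
    and t9: "t9 \<le> (k + k) * Suc (n * 2)"
    by (elim runsE conjE)
  note known = known r9 changes_only_fst[OF c9] changes_only_block[OF c9] changes_only_snd[OF c9]
  have "runs K E (MatMul ''M'' ''QA'' ''c'' idx_2k idx_n idx_k) s9
      (\<lambda>s'. changes_only {''M'', ''t''} s9 s' \<and> block s' ''M'' (k + k) k = mat_adjoint Q * c)
      ((k + k) * Suc (k * Suc (1 + n * 3)))"
    using runs_MatMul[of idx_2k idx_n idx_k s9 "k + k" n k "''QA''" "''M''" "''c''" K E]
    by (simp add: known)
  then obtain s10 t10 where e10: "exec K E (MatMul ''M'' ''QA'' ''c'' idx_2k idx_n idx_k) s9 = (s10, t10)"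
    and c10: "changes_only {''M'', ''t''} s9 s10" and r10: "block s10 ''M'' (k + k) k = mat_adjoint Q * c"
    and t10: "t10 \<le> (k + k) * Suc (k * Suc (1 + n * 3))"
    by (elim runsE conjE)
  note known = known r10 changes_only_fst[OF c10] changes_only_block[OF c10] changes_only_snd[OF c10]
  have "runs K E (MatMul ''B'' ''QA'' ''b'' idx_2k idx_n idx_k) s10
      (\<lambda>s'. changes_only {''B'', ''t''} s10 s' \<and> block s' ''B'' (k + k) k = mat_adjoint Q * b)
      ((k + k) * Suc (k * Suc (1 + n * 3)))"
    using runs_MatMul[of idx_2k idx_n idx_k s10 "k + k" n k "''QA''" "''B''" "''b''" K E]
    by (simp add: known)
  then obtain s11 t11 where e11: "exec K E (MatMul ''B'' ''QA'' ''b'' idx_2k idx_n idx_k) s10 = (s11, t11)"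
    and c11: "changes_only {''B'', ''t''} s10 s11" and r11: "block s11 ''B'' (k + k) k = mat_adjoint Q * b"
    and t11: "t11 \<le> (k + k) * Suc (k * Suc (1 + n * 3))"
    by (elim runsE conjE)
  note known = known r11 changes_only_fst[OF c11] changes_only_block[OF c11] changes_only_snd[OF c11]
  have "runs K E (MatAdj ''BA'' ''B'' idx_k idx_2k) s11
      (\<lambda>s'. changes_only {''BA'', ''t''} s11 s' \<and> block s' ''BA'' k (k + k) = mat_adjoint (mat_adjoint Q * b))
      (k * Suc ((k + k) * 2))"
    using runs_MatAdj[of idx_k idx_2k s11 k "k + k" "''B''" "''BA''" K E]
    by (simp add: known)
  then obtain s12 t12 where e12: "exec K E (MatAdj ''BA'' ''B'' idx_k idx_2k) s11 = (s12, t12)"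
    and c12: "changes_only {''BA'', ''t''} s11 s12" and r12: "block s12 ''BA'' k (k + k) = mat_adjoint (mat_adjoint Q * b)"
    and t12: "t12 \<le> k * Suc ((k + k) * 2)"
    by (elim runsE conjE)
  note known = known r12 changes_only_fst[OF c12] changes_only_block[OF c12] changes_only_snd[OF c12]
  define N where "N = (mat_adjoint Q * c) * mat_adjoint (mat_adjoint Q * b)"
  have "runs K E (MatMul ''N'' ''M'' ''BA'' idx_2k idx_k idx_2k) s12
      (\<lambda>s'. changes_only {''N'', ''t''} s12 s' \<and> block s' ''N'' (k + k) (k + k) = N)
      ((k + k) * Suc ((k + k) * Suc (1 + k * 3)))"
    using runs_MatMul[of idx_2k idx_k idx_2k s12 "k + k" k "k + k" "''M''" "''N''" "''BA''" K E]
    by (simp add: known N_def)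
  then obtain s13 t13 where e13: "exec K E (MatMul ''N'' ''M'' ''BA'' idx_2k idx_k idx_2k) s12 = (s13, t13)"
    and c13: "changes_only {''N'', ''t''} s12 s13" and r13: "block s13 ''N'' (k + k) (k + k) = N"
    and t13: "t13 \<le> (k + k) * Suc ((k + k) * Suc (1 + k * 3))"
    by (elim runsE conjE)
  note known = known r13 changes_only_fst[OF c13] changes_only_block[OF c13] changes_only_snd[OF c13]
  define S where
    "S = mat (k + k) (k + k) (\<lambda>(i, j). (- of_real \<eta> / 2) * (N $$ (i, j) - cnj (N $$ (j, i))))"
  have "runs K E (SkewPart ''S'' ''N'' ''eta'' idx_2k) s13
      (\<lambda>s'. changes_only {''S'', ''t''} s13 s' \<and> block s' ''S'' (k + k) (k + k) = S)
      ((k + k) * Suc ((k + k) * 6))"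
    using runs_SkewPart[of idx_2k s13 "k + k" "''N''" "''S''" "''eta''" K E]
    by (simp add: known S_def)
  then obtain s14 t14 where e14: "exec K E (SkewPart ''S'' ''N'' ''eta'' idx_2k) s13 = (s14, t14)"
    and c14: "changes_only {''S'', ''t''} s13 s14" and r14: "block s14 ''S'' (k + k) (k + k) = S"
    and t14: "t14 \<le> (k + k) * Suc ((k + k) * 6)"
    by (elim runsE conjE)
  note known = known r14 changes_only_fst[OF c14] changes_only_block[OF c14] changes_only_snd[OF c14]
  obtain R l where ES: "E S = (R, l)" by fastforce
  have "S \<in> carrier_mat (k + k) (k + k)" "mat_adjoint S = - S"
    by (auto simp: S_def field_simps intro!: eq_matI)
  from eigensolver_skew_hermitian(1)[OF E this ES] have R: "R \<in> carrier_mat (k + k) (k + k)"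
    by (simp add: unitary_mat_def)
  have "runs K E (Eigen idx_2k ''S'' ''R'' ''D'') s14
      (\<lambda>s'. changes_only {''R'', ''D''} s14 s' \<and> block s' ''R'' (k + k) (k + k) = R \<and> (\<forall>i<k + k. snd s' ''D'' i 0 = l $ i))
      (K * (k + k) ^ 3)"
    by (rule runs_Eigen) (simp_all add: known ES R)
  then obtain s15 t15 where e15: "exec K E (Eigen idx_2k ''S'' ''R'' ''D'') s14 = (s15, t15)"
    and c15: "changes_only {''R'', ''D''} s14 s15" and r15: "block s15 ''R'' (k + k) (k + k) = R"
    and z15: "\<forall>i<k + k. snd s15 ''D'' i 0 = l $ i" and t15: "t15 \<le> K * (k + k) ^ 3"
    by (elim runsE conjE)
  note known = known r15 changes_only_fst[OF c15] changes_only_block[OF c15] changes_only_snd[OF c15]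
  define F where "F = Q * R"
  have "runs K E (MatMul ''F'' ''Q'' ''R'' idx_n idx_2k idx_2k) s15
      (\<lambda>s'. changes_only {''F'', ''t''} s15 s' \<and> block s' ''F'' n (k + k) = F)
      (n * Suc ((k + k) * Suc (1 + (k + k) * 3)))"
    using runs_MatMul[of idx_n idx_2k idx_2k s15 n "k + k" "k + k" "''Q''" "''F''" "''R''" K E]
    by (simp add: known F_def)
  then obtain s16 t16 where e16: "exec K E (MatMul ''F'' ''Q'' ''R'' idx_n idx_2k idx_2k) s15 = (s16, t16)"
    and c16: "changes_only {''F'', ''t''} s15 s16" and r16: "block s16 ''F'' n (k + k) = F"
    and t16: "t16 \<le> n * Suc ((k + k) * Suc (1 + (k + k) * 3))"
    by (elim runsE conjE)
  note known = known r16 changes_only_fst[OF c16] changes_only_block[OF c16] changes_only_snd[OF c16]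
  have "runs K E (MatMul ''H'' ''U'' ''F'' idx_n idx_n idx_2k) s16
      (\<lambda>s'. changes_only {''H'', ''t''} s16 s' \<and> block s' ''H'' n (k + k) = U * F)
      (n * Suc ((k + k) * Suc (1 + n * 3)))"
    using runs_MatMul[of idx_n idx_n idx_2k s16 n n "k + k" "''U''" "''H''" "''F''" K E]
    by (simp add: known)
  then obtain s17 t17 where e17: "exec K E (MatMul ''H'' ''U'' ''F'' idx_n idx_n idx_2k) s16 = (s17, t17)"
    and c17: "changes_only {''H'', ''t''} s16 s17" and r17: "block s17 ''H'' n (k + k) = U * F"
    and t17: "t17 \<le> n * Suc ((k + k) * Suc (1 + n * 3))"
    by (elim runsE conjE)
  note known = known r17 changes_only_fst[OF c17] changes_only_block[OF c17] changes_only_snd[OF c17]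
  define X where "X = mat (k + k) n (\<lambda>(i, j). (exp (l $ i) - 1) * cnj (F $$ (j, i)))"
  have X_eq: "mat (k + k) n (\<lambda>(i, j). (exp (snd s15 ''D'' i 0) - 1) * cnj (F $$ (j, i))) = X"
    unfolding X_def by (rule cong_mat) (use z15 in auto)
  have "runs K E (ExpAdj ''X'' ''F'' ''D'' idx_2k idx_n) s17
      (\<lambda>s'. changes_only {''X'', ''t''} s17 s' \<and> block s' ''X'' (k + k) n = X)
      ((k + k) * Suc (n * 6))"
    using runs_ExpAdj[of idx_2k idx_n s17 "k + k" n "''F''" "''X''" "''D''" K E]
    by (simp add: known X_eq)
  then obtain s18 t18 where e18: "exec K E (ExpAdj ''X'' ''F'' ''D'' idx_2k idx_n) s17 = (s18, t18)"
    and c18: "changes_only {''X'', ''t''} s17 s18" and r18: "block s18 ''X'' (k + k) n = X"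
    and t18: "t18 \<le> (k + k) * Suc (n * 6)"
    by (elim runsE conjE)
  note known = known r18 changes_only_fst[OF c18] changes_only_block[OF c18] changes_only_snd[OF c18]
  have "runs K E (MatAdd ''U'' ''H'' ''X'' idx_n idx_2k idx_n) s18
      (\<lambda>s'. changes_only {''U'', ''t''} s18 s' \<and> block s' ''U'' n n = U + (U * F) * X)
      (n * Suc (n * Suc ((k + k) * 3)))"
    using runs_MatAdd[of idx_n idx_2k idx_n s18 n "k + k" n "''H''" "''U''" "''X''" K E]
    by (simp add: known)
  then obtain s19 t19 where e19: "exec K E (MatAdd ''U'' ''H'' ''X'' idx_n idx_2k idx_n) s18 = (s19, t19)"
    and c19: "changes_only {''U'', ''t''} s18 s19" and r19: "block s19 ''U'' n n = U + (U * F) * X"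
    and t19: "t19 \<le> n * Suc (n * Suc ((k + k) * 3))"
    by (elim runsE conjE)
  note known = known r19 changes_only_fst[OF c19] changes_only_block[OF c19] changes_only_snd[OF c19]
  have "block s19 ''U'' n n = rotation_update U (a * mat_adjoint b) \<eta>"
    unfolding r19 X_def
    by (rule rotation_update_low_rank[OF U a b E c_def V_def EV Q_def N_def S_def ES F_def, symmetric])
  moreover have "t1 + t2 + t3 + t4 + t5 + t6 + t7 + t8 + t9 + t10 + t11 + t12 + t13 + t14 + t15 + t16 + t17 + t18 + t19 \<le> (400 + 16 * K) * (k * (n\<^sup>2 + n * k + k\<^sup>2))"
  proof -
    \<comment> \<open>Since \<open>k\<close> is positive, every monomial of lower degree is
      dominated by \<open>k * (n * n)\<close> or \<open>k * (k * k)\<close>. The costs are then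
      expanded into monomials that \<open>linarith\<close> treats as atoms.\<close>
    have nk_le: "n \<le> k * (n * n)" "k \<le> k * (k * k)" "n * n \<le> k * (n * n)" "k * n \<le> k * (n * n)"
      "k * k \<le> k * (k * k)"
      using k by (auto simp: le_square intro!: mult_le_mono)
    have p1: "t1 \<le> n + 2 * (n * n)"
      using t1 by (simp add: algebra_simps)
    have p2: "t2 \<le> n + 2 * (k * n) + 3 * (k * (n * n))"
      using t2 by (simp add: algebra_simps)
    have p3: "t3 \<le> n + 6 * (k * n)"
      using t3 by (simp add: algebra_simps)
    have p4: "t4 \<le> 2 * k + 4 * (k * n)"
      using t4 by (simp add: algebra_simps)
    have p5: "t5 \<le> 2 * k + 8 * (k * k) + 12 * (k * (k * n))"
      using t5 by (simp add: algebra_simps)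
    \<comment> \<open>The matrix has size \<open>2 k\<close>, whence the factor 8; the two
      eigendecompositions together give the 16 in front of \<open>K\<close>.\<close>
    have p6: "t6 \<le> 8 * (K * (k * (k * k)))"
      using t6 by (simp add: algebra_simps power3_eq_cube)
    have p7: "t7 \<le> n + 4 * (k * n) + 12 * (k * (k * n))"
      using t7 by (simp add: algebra_simps)
    have p8: "t8 \<le> n + 6 * (k * n)"
      using t8 by (simp add: algebra_simps)
    have p9: "t9 \<le> 2 * k + 4 * (k * n)"
      using t9 by (simp add: algebra_simps)
    have p10: "t10 \<le> 2 * k + 4 * (k * k) + 6 * (k * (k * n))"
      using t10 by (simp add: algebra_simps)
    have p11: "t11 \<le> 2 * k + 4 * (k * k) + 6 * (k * (k * n))"
      using t11 by (simp add: algebra_simps)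
    have p12: "t12 \<le> k + 4 * (k * k)"
      using t12 by (simp add: algebra_simps)
    have p13: "t13 \<le> 2 * k + 8 * (k * k) + 12 * (k * (k * k))"
      using t13 by (simp add: algebra_simps)
    have p14: "t14 \<le> 2 * k + 24 * (k * k)"
      using t14 by (simp add: algebra_simps)
    have p15: "t15 \<le> 8 * (K * (k * (k * k)))"
      using t15 by (simp add: algebra_simps power3_eq_cube)
    have p16: "t16 \<le> n + 4 * (k * n) + 12 * (k * (k * n))"
      using t16 by (simp add: algebra_simps)
    have p17: "t17 \<le> n + 4 * (k * n) + 6 * (k * (n * n))"
      using t17 by (simp add: algebra_simps)
    have p18: "t18 \<le> 2 * k + 12 * (k * n)"
      using t18 by (simp add: algebra_simps)
    have p19: "t19 \<le> n + (n * n) + 6 * (k * (n * n))"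
      using t19 by (simp add: algebra_simps)
    \<comment> \<open>The value 400 is generous: after absorption each cubic monomial without
      \<open>K\<close> has a coefficient below 100.\<close>
    have "t1 + t2 + t3 + t4 + t5 + t6 + t7 + t8 + t9 + t10 + t11 + t12 + t13 + t14 + t15 + t16 + t17 + t18 + t19 \<le> 400 * (k * (n * n)) + 400 * (k * (k * n)) + 400 * (k * (k * k)) + 16 * (K * (k * (k * k)))"
      using nk_le p1 p2 p3 p4 p5 p6 p7 p8 p9 p10 p11 p12 p13 p14 p15 p16 p17 p18 p19 by linarith
    also have "\<dots> \<le> (400 + 16 * K) * (k * (n\<^sup>2 + n * k + k\<^sup>2))"
      by (simp add: algebra_simps power2_eq_square)
    finally show ?thesis .
  qed
  \<comment> \<open>\<open>Eigen\<close> is a primitive command, unlike the defined routines; its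
    execution equation is withheld so that \<open>e6\<close> and \<open>e15\<close> apply.\<close>
  ultimately show ?thesis
    by (simp add: runs_def update_steps_def e1 e2 e3 e4 e5 e6 e7 e8 e9 e10 e11 e12 e13 e14 e15 e16 e17 e18 e19 del: exec.simps(7))
qed

text \<open>The general formula is read at \<open>k = 0\<close>, where the correction is a product
  over an empty index range. This justifies a program that does nothing in that case.\<close>

lemma rotation_update_zero_rank:
  fixes U a b :: "complex mat"
  assumes E: "is_eigensolver E" and U: "unitary_mat n U"
    and a: "a \<in> carrier_mat n 0" and b: "b \<in> carrier_mat n 0"
  shows "rotation_update U (a * mat_adjoint b) \<eta> = U"
proof -
  define V where "V = mat n (0 + 0) (\<lambda>(i, j). if j < 0 then (mat_adjoint U * a) $$ (i, j) else b $$ (i, j - 0))"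
  obtain P d where EV: "E (mat_adjoint V * V) = (P, d)" by fastforce
  define Q where "Q = mat n (0 + 0) (\<lambda>(i, j). (V * P) $$ (i, j) / csqrt (d $ j))"
  define N where "N = (mat_adjoint Q * (mat_adjoint U * a)) * mat_adjoint (mat_adjoint Q * b)"
  define S where
    "S = mat (0 + 0) (0 + 0) (\<lambda>(i, j). (- of_real \<eta> / 2) * (N $$ (i, j) - cnj (N $$ (j, i))))"
  obtain R l where ES: "E S = (R, l)" by fastforce
  show ?thesis
    unfolding rotation_update_low_rank[OF U a b E refl V_def EV Q_def N_def S_def ES refl]
    using unitary_matD[OF U] by (intro eq_matI) (auto simp: scalar_prod_def Q_def)
qed

lemma exec_update_prog:
  fixes U :: "complex mat"
  assumes E: "is_eigensolver E" and U: "unitary_mat n U"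
    and input: "holds_input (\<lambda>z. z) n k U a b \<eta> s"
  shows "case exec K E update_prog s of (s', steps) \<Rightarrow>
    holds_matrix (\<lambda>z. z) ''U'' n (rotation_update U (sum_outer n k a b) \<eta>) s' \<and>
    steps \<le> (401 + 16 * K) * (k * (n\<^sup>2 + n * k + k\<^sup>2))"
proof -
  define A where "A = mat n k (\<lambda>(i, l). a l $ i)"
  define B where "B = mat n k (\<lambda>(i, l). b l $ i)"
  have A: "A \<in> carrier_mat n k" and B: "B \<in> carrier_mat n k" by (auto simp: A_def B_def)
  have G: "sum_outer n k a b = A * mat_adjoint B"
    unfolding A_def B_def by (rule sum_outer_eq_mult)
  note input' = input[unfolded holds_input_def holds_matrix_def holds_vectors_def]
  have Ud: "dim_row U = n" "dim_col U = n" using unitary_matD[OF U] by auto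
  show ?thesis
  proof (cases "k = 0")
    case True
    then have "rotation_update U (A * mat_adjoint B) \<eta> = U"
      using rotation_update_zero_rank[OF E U] A B by simp
    then show ?thesis
      using input' True unfolding G by (simp add: update_prog_def holds_matrix_def)
  next
    case False
    define s0 where "s0 = write_index ''w'' 0 s"
    have "runs K E (foldr Seq update_steps Skip) s0
      (\<lambda>s'. block s' ''U'' n n = rotation_update U (A * mat_adjoint B) \<eta>)
      ((400 + 16 * K) * (k * (n\<^sup>2 + n * k + k\<^sup>2)))"
    proof (rule runs_update_steps[OF E U A B])
      show "block s0 ''U'' n n = U" "block s0 ''a'' n k = A" "block s0 ''b'' n k = B"
        using input' Ud by (auto simp: s0_def write_index_def A_def B_def intro!: eq_matI)
    qed (use input' False in \<open>simp_all add: s0_def write_index_def\<close>)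
    then obtain s1 t1 where e: "exec K E (foldr Seq update_steps Skip) s0 = (s1, t1)"
      and U1: "block s1 ''U'' n n = rotation_update U (A * mat_adjoint B) \<eta>"
      and t1: "t1 \<le> (400 + 16 * K) * (k * (n\<^sup>2 + n * k + k\<^sup>2))"
      by (elim runsE)
    \<comment> \<open>By truncated subtraction the loop bound is 1 for positive \<open>k\<close> and
      0 for \<open>k = 0\<close>, so the outer loop acts as a free conditional.\<close>
    have "k - (k - 1) = Suc 0" using False by simp
    then have "exec K E update_prog s = (s1, Suc t1)"
      using input' e by (simp add: update_prog_def s0_def)
    moreover have "holds_matrix (\<lambda>z. z) ''U'' n (rotation_update U (A * mat_adjoint B) \<eta>) s1"
      unfolding U1[symmetric] by (simp add: holds_matrix_def)
    \<comment> \<open>The additional step is the single round of the outer loop. As the budget is at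
      least 1 for positive \<open>k\<close>, it raises 400 to 401.\<close>
    moreover have "Suc t1 \<le> (401 + 16 * K) * (k * (n\<^sup>2 + n * k + k\<^sup>2))"
    proof -
      let ?m = "k * (n\<^sup>2 + n * k + k\<^sup>2)"
      have "0 < ?m" using False by simp
      moreover have "(401 + 16 * K) * ?m = (400 + 16 * K) * ?m + ?m"
        unfolding add_mult_distrib by simp
      ultimately show ?thesis using t1 by linarith
    qed
    ultimately show ?thesis by (simp add: G)
  qed
qed

text \<open>The same store is read as complex input with embedded entries, and the complex result is
  pulled back along the embedding.\<close>

lemma exec_update_prog_real:
  fixes U :: "real mat"
  assumes E: "is_eigensolver E" and U: "unitary_mat n U"
    and ab: "\<forall>l<k. a l \<in> carrier_vec n \<and> b l \<in> carrier_vec n"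
    and input: "holds_input complex_of_real n k U a b \<eta> s"
  shows "case exec K E update_prog s of (s', steps) \<Rightarrow>
    holds_matrix complex_of_real ''U'' n (rotation_update U (sum_outer n k a b) \<eta>) s' \<and>
    steps \<le> (401 + 16 * K) * (k * (n\<^sup>2 + n * k + k\<^sup>2))"
proof -
  let ?U = "map_mat complex_of_real U"
  let ?a = "\<lambda>l. map_vec complex_of_real (a l)" and ?b = "\<lambda>l. map_vec complex_of_real (b l)"
  have Ud: "dim_row U = n" "dim_col U = n" using unitary_matD[OF U] by auto
  have "holds_input (\<lambda>z. z) n k ?U ?a ?b \<eta> s"
    using input ab Ud by (auto simp: holds_input_def holds_matrix_def holds_vectors_def)
  note exec = exec_update_prog[OF E unitary_mat_map_of_real[OF U] this, of K]
  have G: "sum_outer n k a b \<in> carrier_mat n n" by (simp add: sum_outer_def)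
  have "sum_outer n k ?a ?b = map_mat complex_of_real (sum_outer n k a b)"
    using ab by (intro eq_matI) (auto simp: sum_outer_def intro!: sum.cong)
  then have rot: "rotation_update ?U (sum_outer n k ?a ?b) \<eta> =
      map_mat complex_of_real (rotation_update U (sum_outer n k a b) \<eta>)"
    using rotation_update_map_of_real[OF U G] by simp
  have "dim_row (rotation_update U (sum_outer n k a b) \<eta>) = n"
    "dim_col (rotation_update U (sum_outer n k a b) \<eta>) = n"
    using Ud by (auto simp: rotation_update_def mat_exp_def)
  then show ?thesis
    using exec unfolding rot by (auto simp: holds_matrix_def split: prod.splits)
qed

theorem theorem4p4:
  shows
    "(\<forall>n (U :: complex mat) X. unitary_mat n U \<longrightarrow> X \<in> carrier_mat n n \<longrightarrow>
        tangent_proj U X = (1 / 2) \<cdot>\<^sub>m (X - U * mat_adjoint X * U)) \<and>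
     (\<exists>prog. \<forall>K. \<exists>C :: nat. \<forall>E n k (U :: complex mat) a b G \<eta> s.
        is_eigensolver E \<longrightarrow>
        unitary_mat n U \<longrightarrow>
        (\<forall>l<k. a l \<in> carrier_vec n \<and> b l \<in> carrier_vec n) \<longrightarrow>
        G = sum_outer n k a b \<longrightarrow>
        vec_space.rank n G = k \<longrightarrow>
        holds_input (\<lambda>z. z) n k U a b \<eta> s \<longrightarrow>
        (case exec K E prog s of (s', steps) \<Rightarrow>
           holds_matrix (\<lambda>z. z) ''U'' n (rotation_update U G \<eta>) s' \<and>
           steps \<le> C * (k * (n\<^sup>2 + n * k + k\<^sup>2)))) \<and>
     (\<forall>n (U :: real mat) X. unitary_mat n U \<longrightarrow> X \<in> carrier_mat n n \<longrightarrow>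
        tangent_proj U X = (1 / 2) \<cdot>\<^sub>m (X - U * mat_adjoint X * U)) \<and>
     (\<exists>prog. \<forall>K. \<exists>C :: nat. \<forall>E n k (U :: real mat) a b G \<eta> s.
        is_eigensolver E \<longrightarrow>
        unitary_mat n U \<longrightarrow>
        (\<forall>l<k. a l \<in> carrier_vec n \<and> b l \<in> carrier_vec n) \<longrightarrow>
        G = sum_outer n k a b \<longrightarrow>
        vec_space.rank n G = k \<longrightarrow>
        holds_input complex_of_real n k U a b \<eta> s \<longrightarrow>
        (case exec K E prog s of (s', steps) \<Rightarrow>
           holds_matrix complex_of_real ''U'' n (rotation_update U G \<eta>) s' \<and>
           steps \<le> C * (k * (n\<^sup>2 + n * k + k\<^sup>2))))"
proof (intro conjI)
  \<comment> \<open>One program serves both scalar types, and the constant depends on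
    \<open>K\<close> alone.\<close>
  show "\<exists>prog. \<forall>K. \<exists>C :: nat. \<forall>E n k (U :: complex mat) a b G \<eta> s.
        is_eigensolver E \<longrightarrow>
        unitary_mat n U \<longrightarrow>
        (\<forall>l<k. a l \<in> carrier_vec n \<and> b l \<in> carrier_vec n) \<longrightarrow>
        G = sum_outer n k a b \<longrightarrow>
        vec_space.rank n G = k \<longrightarrow>
        holds_input (\<lambda>z. z) n k U a b \<eta> s \<longrightarrow>
        (case exec K E prog s of (s', steps) \<Rightarrow>
           holds_matrix (\<lambda>z. z) ''U'' n (rotation_update U G \<eta>) s' \<and>
           steps \<le> C * (k * (n\<^sup>2 + n * k + k\<^sup>2)))"
    by (rule exI[of _ update_prog], rule allI, rule exI[of _ "401 + 16 * _"], intro allI impI, hypsubst)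
      (rule exec_update_prog)
  show "\<exists>prog. \<forall>K. \<exists>C :: nat. \<forall>E n k (U :: real mat) a b G \<eta> s.
        is_eigensolver E \<longrightarrow>
        unitary_mat n U \<longrightarrow>
        (\<forall>l<k. a l \<in> carrier_vec n \<and> b l \<in> carrier_vec n) \<longrightarrow>
        G = sum_outer n k a b \<longrightarrow>
        vec_space.rank n G = k \<longrightarrow>
        holds_input complex_of_real n k U a b \<eta> s \<longrightarrow>
        (case exec K E prog s of (s', steps) \<Rightarrow>
           holds_matrix complex_of_real ''U'' n (rotation_update U G \<eta>) s' \<and>
           steps \<le> C * (k * (n\<^sup>2 + n * k + k\<^sup>2)))"
    by (rule exI[of _ update_prog], rule allI, rule exI[of _ "401 + 16 * _"], intro allI impI, hypsubst)
      (rule exec_update_prog_real)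
qed (use tangent_proj_complex tangent_proj_real in blast)+

end
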